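(* Let $\mathcal{A}$, $\mathcal{B}$, and $\mathcal{I}$ be categories, together with functors $\mathbf{F}\colon\mathcal{A}\to\mathcal{B}$ and $\mathbb{D}\colon\mathcal{I}\to\mathrm{Retr}(\mathcal{B},\mathcal{B})$. Denote by $\Pi$ the projection functor from $\mathrm{Retr}(\mathcal{B},\mathcal{B})$ to $\mathcal{B}$, and assume the following: (i) the category $\mathcal{A}$ has directed $\omega$-colimits; (ii) the category $\mathcal{B}$ has nonempty finite products; (iii) the functor $\mathbf{F}$ preserves directed $\omega$-colimits; (iv) the functor $\mathbf{F}$ is projectable. If the unfolding $\widetilde{\mathbb{D}}\colon\mathcal{I}\times\omega\to\mathcal{B}$ of $\mathbb{D}$ has a lifting with respect to $\mathbf{F}$, then so does the composition $\Pi\mathbb{D}\colon\mathcal{I}\to\mathcal{B}$.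
   Context: **The category $\mathrm{Retr}(\mathcal{B},\mathcal{B})$.** Its objects are the quadruples $\langle A,B,\varepsilon,\mu\rangle$ with $A,B$ objects of $\mathcal{B}$, $\varepsilon\colon A\to B$ and $\mu\colon B\to A$ morphisms of $\mathcal{B}$, and $\mu\circ\varepsilon=\mathrm{id}_A$. A morphism from $\langle A,B,\varepsilon,\mu\rangle$ to $\langle A',B',\varepsilon',\mu'\rangle$ is a pair $\langle f,g\rangle$ with $f\colon A\to A'$, $g\colon B\to B'$ in $\mathcal{B}$, $g\circ\varepsilon=\varepsilon'\circ f$ and $\mu'\circ g=f\circ\mu$; composition is componentwise. The projection functor $\Pi$ sends $\langle A,B,\varepsilon,\mu\rangle$ to $A$ and $\langle f,g\rangle$ to $f$. **Directed $\omega$-colimits.** $\mathcal{A}$ has directed $\omega$-colimits if every diagram $A_0\to A_1\to A_2\to\cdots$ in $\mathcal{A}$, indexed by the poset $\omega=\{0,1,2,\dots\}$, has a colimit. $\mathbf{F}$ preserves directed $\omega$-colimits if, whenever $A$ is the colimit of such a diagram with transition morphisms $f_n\colon A_n\to A_{n+1}$ and limiting morphisms $g_n\colon A_n\to A$, $\mathbf{F}(A)$ is the colimit of the diagram of the $\mathbf{F}(A_n)$ with transition morphisms $\mathbf{F}(f_n)$ and limiting morphisms $\mathbf{F}(g_n)$. **Liftings.** A lifting of a functor $\mathbf{D}\colon\mathcal{J}\to\mathcal{B}$ with respect to $\mathbf{F}\colon\mathcal{A}\to\mathcal{B}$ is a functor $\mathbf{E}\colon\mathcal{J}\to\mathcal{A}$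 such that $\mathbf{F}\mathbf{E}$ is naturally isomorphic to $\mathbf{D}$. **Projectable functors.** A morphism $f\colon A\to B$ of a category is a projection if there are an object $B'$ and a morphism $f'\colon A\to B'$ such that $A$ is the product of $B$ and $B'$ with projections $f$ and $f'$. Let $\mathbf{F}\colon\mathcal{A}\to\mathcal{B}$ be a functor, $A$ an object of $\mathcal{A}$, $B$ an object of $\mathcal{B}$, $\varphi\colon\mathbf{F}(A)\to B$. A projectability witness for $\langle\varphi,A,B\rangle$ with respect to $\mathbf{F}$ is a pair $\langle a,\varepsilon\rangle$ such that: (1) $a\colon A\to\overline{A}$ is an epimorphism of $\mathcal{A}$; (2) $\varepsilon\colon\mathbf{F}(\overline{A})\to B$ is an isomorphism of $\mathcal{B}$; (3) $\varphi=\varepsilon\circ\mathbf{F}(a)$; (4) for every $f\colon A\to X$ in $\mathcal{A}$ and every $\eta\colon\mathbf{F}(\overline{A})\to\mathbf{F}(X)$ in $\mathcal{B}$ with $\mathbf{F}(f)=\eta\circ\mathbf{F}(a)$, there is $g\colon\overline{A}\to X$ in $\mathcal{A}$ with $f=g\circ a$ and $\eta=\mathbf{F}(g)$. The functor $\mathbf{F}$ is projectable if every triple $\langle\varphi,A,B\rangle$, where $\varphi\colon\mathbf{F}(A)\to B$ is a projection, has a projectability witness. **The unfolding.** Assume that $\mathcal{B}$ has nonempty finite products. Write $\mathbb{D}(X)=\langle\mathbf{D}(X),\widehat{\mathbf{D}}(X),\varepsilon_X,\mu_X\rangle$ and $\mathbb{D}(f)=\langle\mathbf{D}(f),\widehat{\mathbf{D}}(f)\rangle$,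 and $\rho_X=\varepsilon_X\circ\mu_X\colon\widehat{\mathbf{D}}(X)\to\widehat{\mathbf{D}}(X)$. Set $\widehat{\mathbf{D}}^1(X)=\widehat{\mathbf{D}}(X)$, $\alpha^X_1=\mathrm{id}_{\widehat{\mathbf{D}}(X)}$, and for $n\ge1$ let $\widehat{\mathbf{D}}^{n+1}(X)$ be the product of $\widehat{\mathbf{D}}(X)$ and $\widehat{\mathbf{D}}^n(X)$, with projections $\alpha^X_{n+1}\colon\widehat{\mathbf{D}}^{n+1}(X)\to\widehat{\mathbf{D}}(X)$ and $\pi^X_{n+1}\colon\widehat{\mathbf{D}}^{n+1}(X)\to\widehat{\mathbf{D}}^n(X)$. Let $\sigma^X_n\colon\widehat{\mathbf{D}}^n(X)\to\widehat{\mathbf{D}}^{n+1}(X)$ be the unique morphism with $\alpha^X_{n+1}\circ\sigma^X_n=\rho_X\circ\alpha^X_n$ and $\pi^X_{n+1}\circ\sigma^X_n=\mathrm{id}$. For $f\colon X\to Y$ in $\mathcal{I}$, set $\widehat{\mathbf{D}}^1(f)=\widehat{\mathbf{D}}(f)$ and let $\widehat{\mathbf{D}}^{n+1}(f)\colon\widehat{\mathbf{D}}^{n+1}(X)\to\widehat{\mathbf{D}}^{n+1}(Y)$ be the unique morphism with $\alpha^Y_{n+1}\circ\widehat{\mathbf{D}}^{n+1}(f)=\widehat{\mathbf{D}}(f)\circ\alpha^X_{n+1}$ and $\pi^Y_{n+1}\circ\widehat{\mathbf{D}}^{n+1}(f)=\widehat{\mathbf{D}}^n(f)\circ\pi^X_{n+1}$.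 The unfolding of $\mathbb{D}$ is the functor $\widetilde{\mathbb{D}}\colon\mathcal{I}\times\omega\to\mathcal{B}$ (the poset $\omega$ being viewed as a category) given by $\widetilde{\mathbb{D}}(X,n)=\widehat{\mathbf{D}}^{n+1}(X)$ and, for $f\colon X\to Y$ in $\mathcal{I}$ and $m\le n<\omega$, $\widetilde{\mathbb{D}}(f,(m\to n))=\sigma^Y_n\circ\cdots\circ\sigma^Y_{m+1}\circ\widehat{\mathbf{D}}^{m+1}(f)$. *)

theory Defs
  imports Main
begin

section \<open>Categories, functors, natural isomorphisms\<close>

record ('o, 'm) cat =
  Obj  :: "'o set"
  Mor  :: "'m set"
  Dom  :: "'m \<Rightarrow> 'o"
  Cod  :: "'m \<Rightarrow> 'o"
  Id   :: "'o \<Rightarrow> 'm"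
  Comp :: "'m \<Rightarrow> 'm \<Rightarrow> 'm"  (infixr \<open>\<odot>\<index>\<close> 70)

definition hom :: "('o, 'm) cat \<Rightarrow> 'o \<Rightarrow> 'o \<Rightarrow> 'm set" where
  "hom C a b = {f \<in> Mor C. Dom C f = a \<and> Cod C f = b}"

text \<open>As usual in HOL, \<open>Comp\<close> and \<open>Id\<close> are total functions that are only specified on
  composable pairs of morphisms and on objects, respectively; the composite of \<open>f\<close> followed by
  \<open>g\<close> is written \<open>g \<odot> f\<close>.\<close>

locale category =
  fixes C :: "('o, 'm) cat" (structure)
  assumes Dom_in: "f \<in> Mor C \<Longrightarrow> Dom C f \<in> Obj C"
    and Cod_in: "f \<in> Mor C \<Longrightarrow> Cod C f \<in> Obj C"
    and Id_hom: "a \<in> Obj C \<Longrightarrow> Id C a \<in> hom C a a"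
    and Comp_hom: "f \<in> hom C a b \<Longrightarrow> g \<in> hom C b c \<Longrightarrow> g \<odot> f \<in> hom C a c"
    and Comp_Id: "f \<in> hom C a b \<Longrightarrow> f \<odot> Id C a = f"
    and Id_Comp: "f \<in> hom C a b \<Longrightarrow> Id C b \<odot> f = f"
    and Comp_assoc: "f \<in> hom C a b \<Longrightarrow> g \<in> hom C b c \<Longrightarrow> h \<in> hom C c d \<Longrightarrow>
                       (h \<odot> g) \<odot> f = h \<odot> (g \<odot> f)"

record ('o1, 'm1, 'o2, 'm2) functor_data =
  on_obj :: "'o1 \<Rightarrow> 'o2"
  on_mor :: "'m1 \<Rightarrow> 'm2"

definition is_functor ::
    "('o1, 'm1) cat \<Rightarrow> ('o2, 'm2) cat \<Rightarrow> ('o1, 'm1, 'o2, 'm2) functor_data \<Rightarrow> bool" where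
  "is_functor C D F \<longleftrightarrow>
     (\<forall>a \<in> Obj C. on_obj F a \<in> Obj D) \<and>
     (\<forall>f \<in> Mor C. on_mor F f \<in> hom D (on_obj F (Dom C f)) (on_obj F (Cod C f))) \<and>
     (\<forall>a \<in> Obj C. on_mor F (Id C a) = Id D (on_obj F a)) \<and>
     (\<forall>f \<in> Mor C. \<forall>g \<in> Mor C. Cod C f = Dom C g \<longrightarrow>
        on_mor F (g \<odot>\<^bsub>C\<^esub> f) = on_mor F g \<odot>\<^bsub>D\<^esub> on_mor F f)"

definition functor_comp ::
    "('o2, 'm2, 'o3, 'm3) functor_data \<Rightarrow> ('o1, 'm1, 'o2, 'm2) functor_data \<Rightarrow>
     ('o1, 'm1, 'o3, 'm3) functor_data" where
  "functor_comp G F = \<lparr> on_obj = on_obj G \<circ> on_obj F, on_mor = on_mor G \<circ> on_mor F \<rparr>"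

definition epimorphism :: "('o, 'm) cat \<Rightarrow> 'm \<Rightarrow> bool" where
  "epimorphism C f \<longleftrightarrow> f \<in> Mor C \<and>
     (\<forall>c \<in> Obj C. \<forall>g \<in> hom C (Cod C f) c. \<forall>h \<in> hom C (Cod C f) c.
        g \<odot>\<^bsub>C\<^esub> f = h \<odot>\<^bsub>C\<^esub> f \<longrightarrow> g = h)"

definition isomorphism :: "('o, 'm) cat \<Rightarrow> 'm \<Rightarrow> bool" where
  "isomorphism C f \<longleftrightarrow> f \<in> Mor C \<and>
     (\<exists>g \<in> hom C (Cod C f) (Dom C f).
        g \<odot>\<^bsub>C\<^esub> f = Id C (Dom C f) \<and> f \<odot>\<^bsub>C\<^esub> g = Id C (Cod C f))"

definition naturally_isomorphic ::
    "('o1, 'm1) cat \<Rightarrow> ('o2, 'm2) cat \<Rightarrow> ('o1, 'm1, 'o2, 'm2) functor_data \<Rightarrow>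
     ('o1, 'm1, 'o2, 'm2) functor_data \<Rightarrow> bool" where
  "naturally_isomorphic C D F G \<longleftrightarrow>
     (\<exists>\<tau>. (\<forall>a \<in> Obj C. \<tau> a \<in> hom D (on_obj F a) (on_obj G a) \<and> isomorphism D (\<tau> a)) \<and>
          (\<forall>f \<in> Mor C. \<tau> (Cod C f) \<odot>\<^bsub>D\<^esub> on_mor F f = on_mor G f \<odot>\<^bsub>D\<^esub> \<tau> (Dom C f)))"

definition is_lifting ::
    "('j, 'jm) cat \<Rightarrow> ('a, 'am) cat \<Rightarrow> ('b, 'bm) cat \<Rightarrow> ('a, 'am, 'b, 'bm) functor_data \<Rightarrow>
     ('j, 'jm, 'b, 'bm) functor_data \<Rightarrow> ('j, 'jm, 'a, 'am) functor_data \<Rightarrow> bool" where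
  "is_lifting J A B F D E \<longleftrightarrow>
     is_functor J A E \<and> naturally_isomorphic J B (functor_comp F E) D"

definition has_lifting ::
    "('j, 'jm) cat \<Rightarrow> ('a, 'am) cat \<Rightarrow> ('b, 'bm) cat \<Rightarrow> ('a, 'am, 'b, 'bm) functor_data \<Rightarrow>
     ('j, 'jm, 'b, 'bm) functor_data \<Rightarrow> bool" where
  "has_lifting J A B F D \<longleftrightarrow> (\<exists>E. is_lifting J A B F D E)"


section \<open>The category \<open>I \<times> \<omega>\<close>\<close>

definition omega_cat :: "(nat, nat \<times> nat) cat" where
  "omega_cat = \<lparr> Obj = UNIV, Mor = {(m, n). m \<le> n}, Dom = fst, Cod = snd,
                 Id = (\<lambda>n. (n, n)), Comp = (\<lambda>g f. (fst f, snd g)) \<rparr>"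

definition prod_cat :: "('o1, 'm1) cat \<Rightarrow> ('o2, 'm2) cat \<Rightarrow> ('o1 \<times> 'o2, 'm1 \<times> 'm2) cat" where
  "prod_cat C D =
     \<lparr> Obj = Obj C \<times> Obj D, Mor = Mor C \<times> Mor D,
       Dom = map_prod (Dom C) (Dom D), Cod = map_prod (Cod C) (Cod D),
       Id = map_prod (Id C) (Id D),
       Comp = (\<lambda>g f. (fst g \<odot>\<^bsub>C\<^esub> fst f, snd g \<odot>\<^bsub>D\<^esub> snd f)) \<rparr>"


section \<open>Products\<close>

definition is_product :: "('o, 'm) cat \<Rightarrow> 'i set \<Rightarrow> ('i \<Rightarrow> 'o) \<Rightarrow> 'o \<Rightarrow> ('i \<Rightarrow> 'm) \<Rightarrow> bool" where
  "is_product C K X P p \<longleftrightarrow>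
     P \<in> Obj C \<and> (\<forall>i \<in> K. X i \<in> Obj C \<and> p i \<in> hom C P (X i)) \<and>
     (\<forall>Q \<in> Obj C. \<forall>q. (\<forall>i \<in> K. q i \<in> hom C Q (X i)) \<longrightarrow>
        (\<exists>!h. h \<in> hom C Q P \<and> (\<forall>i \<in> K. p i \<odot>\<^bsub>C\<^esub> h = q i)))"

definition is_binary_product :: "('o, 'm) cat \<Rightarrow> 'o \<Rightarrow> 'o \<Rightarrow> 'o \<Rightarrow> 'm \<Rightarrow> 'm \<Rightarrow> bool" where
  "is_binary_product C a b P p q \<longleftrightarrow>
     P \<in> Obj C \<and> a \<in> Obj C \<and> b \<in> Obj C \<and> p \<in> hom C P a \<and> q \<in> hom C P b \<and>
     (\<forall>Q \<in> Obj C. \<forall>u \<in> hom C Q a. \<forall>v \<in> hom C Q b.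
        \<exists>!h. h \<in> hom C Q P \<and> p \<odot>\<^bsub>C\<^esub> h = u \<and> q \<odot>\<^bsub>C\<^esub> h = v)"

definition has_nonempty_finite_products :: "('o, 'm) cat \<Rightarrow> bool" where
  "has_nonempty_finite_products C \<longleftrightarrow>
     (\<forall>n > 0. \<forall>X :: nat \<Rightarrow> 'o. (\<forall>i < n. X i \<in> Obj C) \<longrightarrow> (\<exists>P p. is_product C {..<n} X P p))"

definition is_projection :: "('o, 'm) cat \<Rightarrow> 'm \<Rightarrow> bool" where
  "is_projection C f \<longleftrightarrow>
     f \<in> Mor C \<and> (\<exists>b' f'. is_binary_product C (Cod C f) b' (Dom C f) f f')"


section \<open>Directed \<open>\<omega>\<close>-colimits\<close>

definition omega_diagram :: "('o, 'm) cat \<Rightarrow> (nat \<Rightarrow> 'o) \<Rightarrow> (nat \<Rightarrow> 'm) \<Rightarrow> bool" where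
  "omega_diagram C X f \<longleftrightarrow> (\<forall>n. X n \<in> Obj C \<and> f n \<in> hom C (X n) (X (Suc n)))"

definition omega_cocone ::
    "('o, 'm) cat \<Rightarrow> (nat \<Rightarrow> 'o) \<Rightarrow> (nat \<Rightarrow> 'm) \<Rightarrow> 'o \<Rightarrow> (nat \<Rightarrow> 'm) \<Rightarrow> bool" where
  "omega_cocone C X f L g \<longleftrightarrow>
     L \<in> Obj C \<and> (\<forall>n. g n \<in> hom C (X n) L \<and> g (Suc n) \<odot>\<^bsub>C\<^esub> f n = g n)"

definition omega_colimit ::
    "('o, 'm) cat \<Rightarrow> (nat \<Rightarrow> 'o) \<Rightarrow> (nat \<Rightarrow> 'm) \<Rightarrow> 'o \<Rightarrow> (nat \<Rightarrow> 'm) \<Rightarrow> bool" where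
  "omega_colimit C X f L g \<longleftrightarrow>
     omega_cocone C X f L g \<and>
     (\<forall>M k. omega_cocone C X f M k \<longrightarrow>
        (\<exists>!h. h \<in> hom C L M \<and> (\<forall>n. h \<odot>\<^bsub>C\<^esub> g n = k n)))"

definition has_omega_colimits :: "('o, 'm) cat \<Rightarrow> bool" where
  "has_omega_colimits C \<longleftrightarrow>
     (\<forall>X f. omega_diagram C X f \<longrightarrow> (\<exists>L g. omega_colimit C X f L g))"

definition preserves_omega_colimits ::
    "('a, 'am) cat \<Rightarrow> ('b, 'bm) cat \<Rightarrow> ('a, 'am, 'b, 'bm) functor_data \<Rightarrow> bool" where
  "preserves_omega_colimits A B F \<longleftrightarrow>
     (\<forall>X f L g. omega_diagram A X f \<longrightarrow> omega_colimit A X f L g \<longrightarrow>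
        omega_colimit B (\<lambda>n. on_obj F (X n)) (\<lambda>n. on_mor F (f n))
          (on_obj F L) (\<lambda>n. on_mor F (g n)))"


section \<open>Projectable functors\<close>

definition projectability_witness ::
    "('a, 'am) cat \<Rightarrow> ('b, 'bm) cat \<Rightarrow> ('a, 'am, 'b, 'bm) functor_data \<Rightarrow>
     'bm \<Rightarrow> 'a \<Rightarrow> 'b \<Rightarrow> 'am \<Rightarrow> 'bm \<Rightarrow> bool" where
  "projectability_witness A B F \<phi> X Y a \<epsilon> \<longleftrightarrow>
     (\<exists>Xbar \<in> Obj A.
        a \<in> hom A X Xbar \<and> epimorphism A a \<and>
        \<epsilon> \<in> hom B (on_obj F Xbar) Y \<and> isomorphism B \<epsilon> \<and>
        \<phi> = \<epsilon> \<odot>\<^bsub>B\<^esub> on_mor F a \<and>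
        (\<forall>Z \<in> Obj A. \<forall>f \<in> hom A X Z. \<forall>\<eta> \<in> hom B (on_obj F Xbar) (on_obj F Z).
           on_mor F f = \<eta> \<odot>\<^bsub>B\<^esub> on_mor F a \<longrightarrow>
           (\<exists>g \<in> hom A Xbar Z. f = g \<odot>\<^bsub>A\<^esub> a \<and> \<eta> = on_mor F g)))"

definition projectable ::
    "('a, 'am) cat \<Rightarrow> ('b, 'bm) cat \<Rightarrow> ('a, 'am, 'b, 'bm) functor_data \<Rightarrow> bool" where
  "projectable A B F \<longleftrightarrow>
     (\<forall>X \<in> Obj A. \<forall>Y \<in> Obj B. \<forall>\<phi> \<in> hom B (on_obj F X) Y.
        is_projection B \<phi> \<longrightarrow> (\<exists>a \<epsilon>. projectability_witness A B F \<phi> X Y a \<epsilon>))"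


section \<open>The category of retracts\<close>

text \<open>The object \<open>\<langle>A, B, \<epsilon>, \<mu>\<rangle>\<close> has components \<open>sub_obj\<close>, \<open>top_obj\<close>, \<open>sect\<close>, \<open>retr\<close>.\<close>

record ('o, 'm) retract =
  sub_obj :: 'o
  top_obj :: 'o
  sect    :: 'm
  retr    :: 'm

text \<open>A morphism \<open>\<langle>f, g\<rangle>\<close> carries its source and target, since the same pair \<open>\<langle>f, g\<rangle>\<close> may be
  a morphism between different retracts.\<close>

record ('o, 'm) retract_mor =
  source  :: "('o, 'm) retract"
  target  :: "('o, 'm) retract"
  sub_mor :: 'm
  top_mor :: 'm

definition is_retract :: "('o, 'm) cat \<Rightarrow> ('o, 'm) retract \<Rightarrow> bool" where
  "is_retract B R \<longleftrightarrow>
     sub_obj R \<in> Obj B \<and> top_obj R \<in> Obj B \<and>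
     sect R \<in> hom B (sub_obj R) (top_obj R) \<and> retr R \<in> hom B (top_obj R) (sub_obj R) \<and>
     retr R \<odot>\<^bsub>B\<^esub> sect R = Id B (sub_obj R)"

definition is_retract_mor :: "('o, 'm) cat \<Rightarrow> ('o, 'm) retract_mor \<Rightarrow> bool" where
  "is_retract_mor B t \<longleftrightarrow>
     is_retract B (source t) \<and> is_retract B (target t) \<and>
     sub_mor t \<in> hom B (sub_obj (source t)) (sub_obj (target t)) \<and>
     top_mor t \<in> hom B (top_obj (source t)) (top_obj (target t)) \<and>
     top_mor t \<odot>\<^bsub>B\<^esub> sect (source t) = sect (target t) \<odot>\<^bsub>B\<^esub> sub_mor t \<and>
     retr (target t) \<odot>\<^bsub>B\<^esub> top_mor t = sub_mor t \<odot>\<^bsub>B\<^esub> retr (source t)"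

definition Retr :: "('o, 'm) cat \<Rightarrow> (('o, 'm) retract, ('o, 'm) retract_mor) cat" where
  "Retr B =
     \<lparr> Obj = {R. is_retract B R}, Mor = {t. is_retract_mor B t}, Dom = source, Cod = target,
       Id = (\<lambda>R. \<lparr> source = R, target = R,
                    sub_mor = Id B (sub_obj R), top_mor = Id B (top_obj R) \<rparr>),
       Comp = (\<lambda>t s. \<lparr> source = source s, target = target t,
                        sub_mor = sub_mor t \<odot>\<^bsub>B\<^esub> sub_mor s,
                        top_mor = top_mor t \<odot>\<^bsub>B\<^esub> top_mor s \<rparr>) \<rparr>"

definition Retr_proj :: "(('o, 'm) retract, ('o, 'm) retract_mor, 'o, 'm) functor_data" where
  "Retr_proj = \<lparr> on_obj = sub_obj, on_mor = sub_mor \<rparr>"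


section \<open>The unfolding\<close>

text \<open>The iterated products are determined only up to isomorphism, so they enter as a parameter:
  an element of type \<open>powers\<close> is a choice of them, and \<open>are_powers\<close> says that the choice is correct.
  Indices are shifted down by one: \<open>pow T X n\<close> is the product of \<open>n + 1\<close> copies of
  \<open>top_obj (on_obj D X)\<close>, and \<open>pr_alpha\<close>, \<open>pr_pi\<close>, \<open>sigma\<close>, \<open>pow_mor\<close> are shifted accordingly.
  The value of \<open>pr_pi T X 0\<close> is irrelevant.\<close>

record ('i, 'o, 'm) powers =
  pow      :: "'i \<Rightarrow> nat \<Rightarrow> 'o"
  pr_alpha :: "'i \<Rightarrow> nat \<Rightarrow> 'm"
  pr_pi    :: "'i \<Rightarrow> nat \<Rightarrow> 'm"

definition are_powers ::
    "('i, 'im) cat \<Rightarrow> ('b, 'bm) cat \<Rightarrow>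
     ('i, 'im, ('b, 'bm) retract, ('b, 'bm) retract_mor) functor_data \<Rightarrow>
     ('i, 'b, 'bm) powers \<Rightarrow> bool" where
  "are_powers I B D T \<longleftrightarrow>
     (\<forall>X \<in> Obj I.
        pow T X 0 = top_obj (on_obj D X) \<and>
        pr_alpha T X 0 = Id B (top_obj (on_obj D X)) \<and>
        (\<forall>n. is_binary_product B (top_obj (on_obj D X)) (pow T X n)
                (pow T X (Suc n)) (pr_alpha T X (Suc n)) (pr_pi T X (Suc n))))"

definition rho ::
    "('b, 'bm) cat \<Rightarrow> ('i, 'im, ('b, 'bm) retract, ('b, 'bm) retract_mor) functor_data \<Rightarrow>
     'i \<Rightarrow> 'bm" where
  "rho B D X = sect (on_obj D X) \<odot>\<^bsub>B\<^esub> retr (on_obj D X)"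

definition sigma ::
    "('b, 'bm) cat \<Rightarrow> ('i, 'im, ('b, 'bm) retract, ('b, 'bm) retract_mor) functor_data \<Rightarrow>
     ('i, 'b, 'bm) powers \<Rightarrow> 'i \<Rightarrow> nat \<Rightarrow> 'bm" where
  "sigma B D T X n =
     (THE s. s \<in> hom B (pow T X n) (pow T X (Suc n)) \<and>
             pr_alpha T X (Suc n) \<odot>\<^bsub>B\<^esub> s = rho B D X \<odot>\<^bsub>B\<^esub> pr_alpha T X n \<and>
             pr_pi T X (Suc n) \<odot>\<^bsub>B\<^esub> s = Id B (pow T X n))"

primrec pow_mor ::
    "('i, 'im) cat \<Rightarrow> ('b, 'bm) cat \<Rightarrow>
     ('i, 'im, ('b, 'bm) retract, ('b, 'bm) retract_mor) functor_data \<Rightarrow>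
     ('i, 'b, 'bm) powers \<Rightarrow> 'im \<Rightarrow> nat \<Rightarrow> 'bm" where
  "pow_mor I B D T f 0 = top_mor (on_mor D f)"
| "pow_mor I B D T f (Suc n) =
     (THE h. h \<in> hom B (pow T (Dom I f) (Suc n)) (pow T (Cod I f) (Suc n)) \<and>
             pr_alpha T (Cod I f) (Suc n) \<odot>\<^bsub>B\<^esub> h =
               top_mor (on_mor D f) \<odot>\<^bsub>B\<^esub> pr_alpha T (Dom I f) (Suc n) \<and>
             pr_pi T (Cod I f) (Suc n) \<odot>\<^bsub>B\<^esub> h =
               pow_mor I B D T f n \<odot>\<^bsub>B\<^esub> pr_pi T (Dom I f) (Suc n))"

text \<open>\<open>sigma_chain B D T Y m k h\<close> is \<open>\<sigma>(m+k-1) \<odot> \<dots> \<odot> \<sigma>(m) \<odot> h\<close>, where \<open>\<sigma>(i) = sigma B D T Y i\<close>.\<close>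

primrec sigma_chain ::
    "('b, 'bm) cat \<Rightarrow> ('i, 'im, ('b, 'bm) retract, ('b, 'bm) retract_mor) functor_data \<Rightarrow>
     ('i, 'b, 'bm) powers \<Rightarrow> 'i \<Rightarrow> nat \<Rightarrow> nat \<Rightarrow> 'bm \<Rightarrow> 'bm" where
  "sigma_chain B D T Y m 0 h = h"
| "sigma_chain B D T Y m (Suc k) h =
     sigma B D T Y (m + k) \<odot>\<^bsub>B\<^esub> sigma_chain B D T Y m k h"

definition unfolding_functor ::
    "('i, 'im) cat \<Rightarrow> ('b, 'bm) cat \<Rightarrow>
     ('i, 'im, ('b, 'bm) retract, ('b, 'bm) retract_mor) functor_data \<Rightarrow>
     ('i, 'b, 'bm) powers \<Rightarrow> ('i \<times> nat, 'im \<times> (nat \<times> nat), 'b, 'bm) functor_data" where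
  "unfolding_functor I B D T =
     \<lparr> on_obj = (\<lambda>(X, n). pow T X n),
       on_mor = (\<lambda>(f, (m, n)). sigma_chain B D T (Cod I f) m (n - m) (pow_mor I B D T f m)) \<rparr>"

end

theory Submission
  imports Defs
begin

text \<open>The retract \<open>\<mu> \<odot> \<epsilon> = id\<close> exhibits \<open>D X\<close> as the colimit of the tower in which every level is
  the ambient object \<open>D' X\<close> of the retract and every step is the idempotent \<open>\<rho> = \<epsilon> \<odot> \<mu>\<close>
  (\<open>omega_colimit_idempotent_tower\<close>). A lifting of this tower therefore yields a lifting of \<open>D\<close>: take
  \<open>\<omega>\<close>-colimits upstairs, which exist and are preserved by \<open>F\<close> (\<open>has_lifting_omega_colimit\<close>).

  The tower itself need not be given with a lifting, but it is a quotient of the unfolding: the defining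
  equation \<open>\<alpha> \<odot> \<sigma> = \<rho> \<odot> \<alpha>\<close> says that the projections \<open>\<alpha>\<close> of the powers of \<open>D' X\<close> onto their newest
  factor commute with the steps of the two diagrams (\<open>alpha_natural\<close>). Projectability of \<open>F\<close> transports
  liftings along natural transformations of this kind (\<open>has_lifting_if_natural_projection\<close>): each
  \<open>\<alpha>\<close> is lifted to an epimorphism with a universal property, which forces the lifted quotients to form
  a diagram again.

  The limit of the projections \<open>\<mu> \<odot> \<alpha>\<close>, from the colimit of the unfolding to \<open>D X\<close>, is in general not a
  projection of a product. For this reason the quotients are taken at the finite levels, before
  passing to the colimit.\<close>

section \<open>Calculating with morphisms, functors and \<open>\<omega>\<close>-colimits\<close>

context category
begin

text \<open>The axioms restated with \<open>Mor\<close>, \<open>Dom\<close> and \<open>Cod\<close> in place of \<open>hom\<close>: all variables of the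
  premises occur in the conclusion, so that these are usable as conditional rewrite rules.\<close>

lemma Comp_in_Mor:
  assumes "f \<in> Mor C" "g \<in> Mor C" "Cod C f = Dom C g"
  shows "g \<odot> f \<in> Mor C" "Dom C (g \<odot> f) = Dom C f" "Cod C (g \<odot> f) = Cod C g"
  using Comp_hom[of f "Dom C f" "Cod C f" g "Cod C g"] assms by (auto simp: hom_def)

lemma Id_in_Mor:
  assumes "a \<in> Obj C"
  shows "Id C a \<in> Mor C" "Dom C (Id C a) = a" "Cod C (Id C a) = a"
  using Id_hom[OF assms] by (auto simp: hom_def)

lemma Id_neutral:
  assumes "f \<in> Mor C"
  shows "Dom C f = a \<Longrightarrow> f \<odot> Id C a = f" "Cod C f = a \<Longrightarrow> Id C a \<odot> f = f"
  using assms Comp_Id[of f] Id_Comp[of f] by (auto simp: hom_def)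

lemma Comp_reassoc:
  assumes "f \<in> Mor C" "g \<in> Mor C" "h \<in> Mor C" "Cod C f = Dom C g" "Cod C g = Dom C h"
  shows "(h \<odot> g) \<odot> f = h \<odot> (g \<odot> f)"
  using Comp_assoc[of f "Dom C f" "Cod C f" g "Cod C g" h "Cod C h"] assms by (auto simp: hom_def)

lemmas arrow_simps = hom_def Dom_in Cod_in Comp_in_Mor Id_in_Mor Id_neutral Comp_reassoc

lemma hom_Obj:
  assumes "f \<in> hom C a b"
  shows "a \<in> Obj C" "b \<in> Obj C"
  using assms Dom_in Cod_in by (auto simp: hom_def)

lemma omega_colimit_cocone:
  assumes "omega_colimit C X f L g"
  shows "L \<in> Obj C" "g n \<in> hom C (X n) L" "g (Suc n) \<odot> f n = g n"
  using assms by (auto simp: omega_colimit_def omega_cocone_def)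

lemma omega_colimit_ext:
  assumes X: "omega_diagram C X f" and L: "omega_colimit C X f L g"
    and h: "h \<in> hom C L M" and h': "h' \<in> hom C L M"
    and eq: "\<And>n. h \<odot> g n = h' \<odot> g n"
  shows "h = h'"
proof -
  have gf: "g (Suc n) \<odot> f n = g n" for n
    by (rule omega_colimit_cocone[OF L])
  have "h \<odot> g n \<in> hom C (X n) M" for n
    using omega_colimit_cocone(2)[OF L] h by (rule Comp_hom)
  moreover have "(h \<odot> g (Suc n)) \<odot> f n = h \<odot> g n" for n
    using Comp_assoc[OF _ omega_colimit_cocone(2)[OF L] h, of "f n" "X n" "Suc n"] X gf
    by (simp add: omega_diagram_def)
  ultimately have "omega_cocone C X f M (\<lambda>n. h \<odot> g n)"
    using hom_Obj(2)[OF h] by (simp add: omega_cocone_def)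
  then have "\<exists>!k. k \<in> hom C L M \<and> (\<forall>n. k \<odot> g n = h \<odot> g n)"
    using L by (simp add: omega_colimit_def)
  with h h' eq show ?thesis
    by metis
qed

lemma omega_colimit_map:
  assumes X: "omega_diagram C X f" and Y: "omega_diagram C Y k"
    and L: "omega_colimit C X f L g" and M: "omega_colimit C Y k M l"
    and t: "\<And>n. t n \<in> hom C (X n) (Y n)"
    and nat: "\<And>n. t (Suc n) \<odot> f n = k n \<odot> t n"
  shows "\<exists>h \<in> hom C L M. \<forall>n. h \<odot> g n = l n \<odot> t n"
proof -
  have l: "l n \<in> hom C (Y n) M" "l (Suc n) \<odot> k n = l n" for n
    using omega_colimit_cocone[OF M] by auto
  have f: "f n \<in> hom C (X n) (X (Suc n))" for n
    using X by (simp add: omega_diagram_def)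
  have k: "k n \<in> hom C (Y n) (Y (Suc n))" for n
    using Y by (simp add: omega_diagram_def)
  have "(l (Suc n) \<odot> t (Suc n)) \<odot> f n = l n \<odot> t n" for n
  proof -
    have "(l (Suc n) \<odot> t (Suc n)) \<odot> f n = l (Suc n) \<odot> (k n \<odot> t n)"
      by (simp add: Comp_assoc[OF f t l(1)] nat)
    also have "\<dots> = l n \<odot> t n"
      by (simp add: Comp_assoc[OF t k l(1), symmetric] l(2))
    finally show ?thesis .
  qed
  then have "omega_cocone C X f M (\<lambda>n. l n \<odot> t n)"
    using omega_colimit_cocone(1)[OF M] Comp_hom[OF t l(1)] by (simp add: omega_cocone_def)
  with L show ?thesis
    unfolding omega_colimit_def by blast
qed

text \<open>The inverses of the \<open>t n\<close> form a map of diagrams in the other direction; the two induced maps of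
  colimits are mutually inverse because their composites fix the limiting morphisms.\<close>

lemma omega_colimit_iso:
  assumes X: "omega_diagram C X f" and Y: "omega_diagram C Y k"
    and L: "omega_colimit C X f L g" and M: "omega_colimit C Y k M l"
    and t: "\<And>n. t n \<in> hom C (X n) (Y n)" and iso: "\<And>n. isomorphism C (t n)"
    and nat: "\<And>n. t (Suc n) \<odot> f n = k n \<odot> t n"
  shows "\<exists>h \<in> hom C L M. isomorphism C h \<and> (\<forall>n. h \<odot> g n = l n \<odot> t n)"
proof -
  have f: "f n \<in> hom C (X n) (X (Suc n))" for n
    using X by (simp add: omega_diagram_def)
  have k: "k n \<in> hom C (Y n) (Y (Suc n))" for n
    using Y by (simp add: omega_diagram_def)
  have g: "g n \<in> hom C (X n) L" for n
    by (rule omega_colimit_cocone[OF L])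
  have l: "l n \<in> hom C (Y n) M" for n
    by (rule omega_colimit_cocone[OF M])
  have "\<forall>n. \<exists>s. s \<in> hom C (Y n) (X n) \<and> s \<odot> t n = Id C (X n) \<and> t n \<odot> s = Id C (Y n)"
    using t iso by (auto simp: isomorphism_def hom_def)
  then obtain s where s: "\<And>n. s n \<in> hom C (Y n) (X n)"
    and st: "\<And>n. s n \<odot> t n = Id C (X n)" and ts: "\<And>n. t n \<odot> s n = Id C (Y n)"
    by metis
  have nat': "s (Suc n) \<odot> k n = f n \<odot> s n" for n
  proof -
    have "s (Suc n) \<odot> k n = s (Suc n) \<odot> (k n \<odot> (t n \<odot> s n))"
      by (simp add: ts Comp_Id[OF k])
    also have "\<dots> = s (Suc n) \<odot> (t (Suc n) \<odot> (f n \<odot> s n))"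
      by (simp add: Comp_assoc[OF s t k, symmetric] nat[symmetric] Comp_assoc[OF s f t])
    also have "\<dots> = f n \<odot> s n"
      by (simp add: Comp_assoc[OF Comp_hom[OF s f] t s, symmetric] st Id_Comp[OF Comp_hom[OF s f]])
    finally show ?thesis .
  qed
  obtain h where h: "h \<in> hom C L M" and hg: "\<And>n. h \<odot> g n = l n \<odot> t n"
    using omega_colimit_map[OF X Y L M t nat] by auto
  obtain h' where h': "h' \<in> hom C M L" and hl: "\<And>n. h' \<odot> l n = g n \<odot> s n"
    using omega_colimit_map[OF Y X M L s nat'] by auto
  have L_Obj: "L \<in> Obj C" and M_Obj: "M \<in> Obj C"
    using hom_Obj[OF h] by auto
  have "(h' \<odot> h) \<odot> g n = Id C L \<odot> g n" for n
  proof -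
    have "(h' \<odot> h) \<odot> g n = (h' \<odot> l n) \<odot> t n"
      by (simp add: Comp_assoc[OF g h h'] hg Comp_assoc[OF t l h'])
    then show ?thesis
      by (simp add: hl Comp_assoc[OF t s g] st Comp_Id[OF g] Id_Comp[OF g])
  qed
  then have 1: "h' \<odot> h = Id C L"
    by (rule omega_colimit_ext[OF X L Comp_hom[OF h h'] Id_hom[OF L_Obj]])
  have "(h \<odot> h') \<odot> l n = Id C M \<odot> l n" for n
  proof -
    have "(h \<odot> h') \<odot> l n = (h \<odot> g n) \<odot> s n"
      by (simp add: Comp_assoc[OF l h' h] hl Comp_assoc[OF s g h])
    then show ?thesis
      by (simp add: hg Comp_assoc[OF s t l] ts Comp_Id[OF l] Id_Comp[OF l])
  qed
  then have 2: "h \<odot> h' = Id C M"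
    by (rule omega_colimit_ext[OF Y M Comp_hom[OF h' h] Id_hom[OF M_Obj]])
  from 1 2 h h' hg show ?thesis
    by (auto simp: isomorphism_def hom_def)
qed

text \<open>A split idempotent, iterated, has the retract as its colimit: in a cocone \<open>k\<close> over the
  constant tower, \<open>k (n + 1)\<close> absorbs the idempotent, hence all \<open>k n\<close> coincide.\<close>

lemma omega_colimit_retract:
  assumes "is_retract C R"
  shows "omega_colimit C (\<lambda>n. top_obj R) (\<lambda>n. sect R \<odot> retr R) (sub_obj R) (\<lambda>n. retr R)"
proof -
  have R: "sub_obj R \<in> Obj C" "sect R \<in> hom C (sub_obj R) (top_obj R)"
      "retr R \<in> hom C (top_obj R) (sub_obj R)"
    and split: "retr R \<odot> sect R = Id C (sub_obj R)"
    using assms by (auto simp: is_retract_def)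
  let ?r = "sect R \<odot> retr R"
  have r: "?r \<in> hom C (top_obj R) (top_obj R)"
    by (rule Comp_hom[OF R(3) R(2)])
  have absorb: "retr R \<odot> ?r = retr R"
    by (simp add: Comp_assoc[OF R(3) R(2) R(3), symmetric] split Id_Comp[OF R(3)])
  have idem: "?r \<odot> ?r = ?r"
    by (simp add: Comp_assoc[OF r R(3) R(2)] absorb)
  have "\<exists>!h. h \<in> hom C (sub_obj R) M \<and> (\<forall>n. h \<odot> retr R = k n)"
    if "omega_cocone C (\<lambda>n. top_obj R) (\<lambda>n. ?r) M k" for M k
  proof -
    have k: "k n \<in> hom C (top_obj R) M" and kr: "k (Suc n) \<odot> ?r = k n" for n
      using that by (auto simp: omega_cocone_def)
    have step: "k (Suc n) = k n" for n
    proof -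
      have "k (Suc n) = k (Suc (Suc n)) \<odot> (?r \<odot> ?r)"
        by (simp only: idem kr)
      also have "\<dots> = k n"
        by (simp only: Comp_assoc[OF r r k, symmetric] kr)
      finally show ?thesis .
    qed
    have const: "k n = k 0" for n
      by (induction n) (simp_all add: step)
    show ?thesis
    proof (rule ex1I[of _ "k 0 \<odot> sect R"])
      have "(k 0 \<odot> sect R) \<odot> retr R = k n" for n
        using kr[of 0] step[of 0] const[of n] by (simp add: Comp_assoc[OF R(3) R(2) k])
      then show "k 0 \<odot> sect R \<in> hom C (sub_obj R) M \<and> (\<forall>n. (k 0 \<odot> sect R) \<odot> retr R = k n)"
        using Comp_hom[OF R(2) k] by blast
    next
      fix h assume h: "h \<in> hom C (sub_obj R) M \<and> (\<forall>n. h \<odot> retr R = k n)"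
      then have "k 0 \<odot> sect R = (h \<odot> retr R) \<odot> sect R"
        by metis
      also have "\<dots> = h"
        using h by (simp add: Comp_assoc[OF R(2) R(3), of h M] split Comp_Id[of h _ M])
      finally show "h = k 0 \<odot> sect R" ..
    qed
  qed
  with R absorb show ?thesis
    by (simp add: omega_colimit_def omega_cocone_def)
qed

end

lemma functor_Obj: "is_functor C D F \<Longrightarrow> a \<in> Obj C \<Longrightarrow> on_obj F a \<in> Obj D"
  by (simp add: is_functor_def)

lemma functor_hom:
  "is_functor C D F \<Longrightarrow> f \<in> hom C a b \<Longrightarrow> on_mor F f \<in> hom D (on_obj F a) (on_obj F b)"
  by (auto simp: is_functor_def hom_def)

lemma functor_Id: "is_functor C D F \<Longrightarrow> a \<in> Obj C \<Longrightarrow> on_mor F (Id C a) = Id D (on_obj F a)"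
  by (simp add: is_functor_def)

lemma functor_Comp:
  "is_functor C D F \<Longrightarrow> f \<in> hom C a b \<Longrightarrow> g \<in> hom C b c \<Longrightarrow>
    on_mor F (g \<odot>\<^bsub>C\<^esub> f) = on_mor F g \<odot>\<^bsub>D\<^esub> on_mor F f"
  by (auto simp: is_functor_def hom_def)

lemma category_omega: "category omega_cat"
  by unfold_locales (auto simp: omega_cat_def hom_def)

lemma category_prod:
  assumes "category C" "category D"
  shows "category (prod_cat C D)"
proof -
  interpret C: category C by fact
  interpret D: category D by fact
  show ?thesis
    by unfold_locales (auto simp: prod_cat_def C.arrow_simps D.arrow_simps)
qed

lemma hom_prod_omega:
  "f \<in> hom I X Y \<Longrightarrow> m \<le> n \<Longrightarrow> (f, (m, n)) \<in> hom (prod_cat I omega_cat) (X, m) (Y, n)"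
  by (simp add: prod_cat_def omega_cat_def hom_def)

lemma Comp_prod_omega:
  "(g, (n, k)) \<odot>\<^bsub>prod_cat I omega_cat\<^esub> (f, (m, n')) = (g \<odot>\<^bsub>I\<^esub> f, (m, k))"
  by (simp add: prod_cat_def omega_cat_def)


section \<open>Lifting quotients along a projectable functor\<close>

text \<open>Choose a projectability witness for every component of the natural transformation. Its universal
  property lifts every morphism \<open>u\<close> of \<open>J\<close>: by naturality, the image under \<open>F\<close> of \<open>E u\<close> followed by the
  quotient at its codomain factors through the quotient at its domain, via \<open>W u\<close> conjugated by the
  isomorphisms of the witnesses. The lifted morphisms are determined by their composites with epimorphisms of \<open>A\<close>,
  and \<open>E\<close> is a functor, so they are functorial.\<close>

lemma has_lifting_if_natural_projection:
  assumes J: "category J" and A: "category A" and B: "category B"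
    and F: "is_functor A B F" and proj: "projectable A B F"
    and E: "is_functor J A E" and W: "is_functor J B W"
    and p: "\<And>X. X \<in> Obj J \<Longrightarrow> p X \<in> hom B (on_obj F (on_obj E X)) (on_obj W X)"
    and p_proj: "\<And>X. X \<in> Obj J \<Longrightarrow> is_projection B (p X)"
    and nat: "\<And>X Y u. u \<in> hom J X Y \<Longrightarrow>
               p Y \<odot>\<^bsub>B\<^esub> on_mor F (on_mor E u) = on_mor W u \<odot>\<^bsub>B\<^esub> p X"
  shows "has_lifting J A B F W"
proof -
  interpret J: category J by fact
  interpret A: category A by fact
  interpret B: category B by fact
  have "\<exists>q e. projectability_witness A B F (p X) (on_obj E X) (on_obj W X) q e"
    if "X \<in> Obj J" for X
    using proj p[OF that] p_proj[OF that] functor_Obj[OF E that] functor_Obj[OF W that]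
    by (auto simp: projectable_def)
  then obtain q e where wit:
    "\<And>X. X \<in> Obj J \<Longrightarrow> projectability_witness A B F (p X) (on_obj E X) (on_obj W X) (q X) (e X)"
    by metis
  define Q where "Q X = Cod A (q X)" for X
  have q: "q X \<in> hom A (on_obj E X) (Q X)" and q_epi: "epimorphism A (q X)"
    and e: "e X \<in> hom B (on_obj F (Q X)) (on_obj W X)" and e_iso: "isomorphism B (e X)"
    and eq: "p X = e X \<odot>\<^bsub>B\<^esub> on_mor F (q X)"
    and univ: "\<And>Z f \<eta>. f \<in> hom A (on_obj E X) Z \<Longrightarrow> \<eta> \<in> hom B (on_obj F (Q X)) (on_obj F Z) \<Longrightarrow>
        on_mor F f = \<eta> \<odot>\<^bsub>B\<^esub> on_mor F (q X) \<Longrightarrow>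
        \<exists>g \<in> hom A (Q X) Z. f = g \<odot>\<^bsub>A\<^esub> q X \<and> \<eta> = on_mor F g"
    if "X \<in> Obj J" for X
    using wit[OF that] A.hom_Obj
    by (fastforce simp: projectability_witness_def hom_def Q_def)+
  have q_cancel: "g = h"
    if "X \<in> Obj J" "g \<in> hom A (Q X) Z" "h \<in> hom A (Q X) Z" "g \<odot>\<^bsub>A\<^esub> q X = h \<odot>\<^bsub>A\<^esub> q X" for X Z g h
    using that q_epi[OF that(1)] A.hom_Obj(2)[OF that(2)]
    by (auto simp: epimorphism_def Q_def)
  have "\<exists>g. g \<in> hom A (Q X) (Q Y) \<and> g \<odot>\<^bsub>A\<^esub> q X = q Y \<odot>\<^bsub>A\<^esub> on_mor E u \<and>
          e Y \<odot>\<^bsub>B\<^esub> on_mor F g = on_mor W u \<odot>\<^bsub>B\<^esub> e X"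
    if u: "u \<in> hom J X Y" for u X Y
  proof -
    note X = J.hom_Obj(1)[OF u] and Y = J.hom_Obj(2)[OF u]
    obtain e' where e': "e' \<in> hom B (on_obj W Y) (on_obj F (Q Y))"
      and e'e: "e' \<odot>\<^bsub>B\<^esub> e Y = Id B (on_obj F (Q Y))"
      and ee': "e Y \<odot>\<^bsub>B\<^esub> e' = Id B (on_obj W Y)"
      using e_iso[OF Y] e[OF Y] by (auto simp: isomorphism_def hom_def)
    \<comment> \<open>The only candidate for the image of the lift under \<open>F\<close>.\<close>
    define \<eta> where "\<eta> = e' \<odot>\<^bsub>B\<^esub> (on_mor W u \<odot>\<^bsub>B\<^esub> e X)"
    note FqX = functor_hom[OF F q[OF X]] and FqY = functor_hom[OF F q[OF Y]]
      and Eu = functor_hom[OF E u] and Wu = functor_hom[OF W u]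
      and FEu = functor_hom[OF F functor_hom[OF E u]]
    note We = B.Comp_hom[OF e[OF X] Wu]
    have \<eta>: "\<eta> \<in> hom B (on_obj F (Q X)) (on_obj F (Q Y))"
      unfolding \<eta>_def by (rule B.Comp_hom[OF We e'])
    have "on_mor F (q Y \<odot>\<^bsub>A\<^esub> on_mor E u) = (e' \<odot>\<^bsub>B\<^esub> e Y) \<odot>\<^bsub>B\<^esub> (on_mor F (q Y) \<odot>\<^bsub>B\<^esub> on_mor F (on_mor E u))"
      by (simp add: functor_Comp[OF F Eu q[OF Y]] e'e B.Id_Comp[OF B.Comp_hom[OF FEu FqY]])
    also have "\<dots> = e' \<odot>\<^bsub>B\<^esub> (p Y \<odot>\<^bsub>B\<^esub> on_mor F (on_mor E u))"
      by (simp add: eq[OF Y] B.Comp_assoc[OF FEu FqY e[OF Y]]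
          B.Comp_assoc[OF B.Comp_hom[OF FEu FqY] e[OF Y] e'])
    also have "\<dots> = e' \<odot>\<^bsub>B\<^esub> (on_mor W u \<odot>\<^bsub>B\<^esub> (e X \<odot>\<^bsub>B\<^esub> on_mor F (q X)))"
      by (simp add: nat[OF u] eq[OF X])
    also have "\<dots> = \<eta> \<odot>\<^bsub>B\<^esub> on_mor F (q X)"
      by (simp add: \<eta>_def B.Comp_assoc[OF FqX We e'] B.Comp_assoc[OF FqX e[OF X] Wu])
    finally obtain g where g: "g \<in> hom A (Q X) (Q Y)" and gq: "q Y \<odot>\<^bsub>A\<^esub> on_mor E u = g \<odot>\<^bsub>A\<^esub> q X"
      and Fg: "\<eta> = on_mor F g"
      using univ[OF X A.Comp_hom[OF Eu q[OF Y]] \<eta>] by auto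
    have "e Y \<odot>\<^bsub>B\<^esub> on_mor F g = on_mor W u \<odot>\<^bsub>B\<^esub> e X"
      by (simp add: Fg[symmetric] \<eta>_def B.Comp_assoc[OF We e' e[OF Y], symmetric] ee' B.Id_Comp[OF We])
    with g gq show ?thesis
      by auto
  qed
  then have "\<exists>g. g \<in> hom A (Q (Dom J u)) (Q (Cod J u)) \<and>
      g \<odot>\<^bsub>A\<^esub> q (Dom J u) = q (Cod J u) \<odot>\<^bsub>A\<^esub> on_mor E u \<and>
      e (Cod J u) \<odot>\<^bsub>B\<^esub> on_mor F g = on_mor W u \<odot>\<^bsub>B\<^esub> e (Dom J u)"
    if "u \<in> Mor J" for u
    using that by (simp add: hom_def)
  then obtain G where "\<And>u. u \<in> Mor J \<Longrightarrow> G u \<in> hom A (Q (Dom J u)) (Q (Cod J u)) \<and>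
      G u \<odot>\<^bsub>A\<^esub> q (Dom J u) = q (Cod J u) \<odot>\<^bsub>A\<^esub> on_mor E u \<and>
      e (Cod J u) \<odot>\<^bsub>B\<^esub> on_mor F (G u) = on_mor W u \<odot>\<^bsub>B\<^esub> e (Dom J u)"
    by metis
  then have G: "G u \<in> hom A (Q X) (Q Y)" and Gq: "G u \<odot>\<^bsub>A\<^esub> q X = q Y \<odot>\<^bsub>A\<^esub> on_mor E u"
    and eG: "e Y \<odot>\<^bsub>B\<^esub> on_mor F (G u) = on_mor W u \<odot>\<^bsub>B\<^esub> e X"
    if "u \<in> hom J X Y" for u X Y
    using that by (auto simp: hom_def)
  have G_Id: "G (Id J X) = Id A (Q X)" if X: "X \<in> Obj J" for X
  proof (rule q_cancel[OF X G[OF J.Id_hom[OF X]] A.Id_hom])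
    show "Q X \<in> Obj A"
      by (rule A.hom_Obj[OF q[OF X]])
    show "G (Id J X) \<odot>\<^bsub>A\<^esub> q X = Id A (Q X) \<odot>\<^bsub>A\<^esub> q X"
      by (simp add: Gq[OF J.Id_hom[OF X]] functor_Id[OF E X] A.Comp_Id[OF q[OF X]] A.Id_Comp[OF q[OF X]])
  qed
  have G_Comp: "G (v \<odot>\<^bsub>J\<^esub> u) = G v \<odot>\<^bsub>A\<^esub> G u"
    if u: "u \<in> hom J X Y" and v: "v \<in> hom J Y Z" for u v X Y Z
  proof (rule q_cancel[OF J.hom_Obj(1)[OF u] G[OF J.Comp_hom[OF u v]] A.Comp_hom[OF G[OF u] G[OF v]]])
    note qX = q[OF J.hom_Obj(1)[OF u]] and qY = q[OF J.hom_Obj(1)[OF v]]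
      and qZ = q[OF J.hom_Obj(2)[OF v]] and Eu = functor_hom[OF E u] and Ev = functor_hom[OF E v]
    have "G (v \<odot>\<^bsub>J\<^esub> u) \<odot>\<^bsub>A\<^esub> q X = (q Z \<odot>\<^bsub>A\<^esub> on_mor E v) \<odot>\<^bsub>A\<^esub> on_mor E u"
      by (simp add: Gq[OF J.Comp_hom[OF u v]] functor_Comp[OF E u v] A.Comp_assoc[OF Eu Ev qZ])
    also have "\<dots> = G v \<odot>\<^bsub>A\<^esub> (q Y \<odot>\<^bsub>A\<^esub> on_mor E u)"
      by (simp add: Gq[OF v, symmetric] A.Comp_assoc[OF Eu qY G[OF v]])
    also have "\<dots> = (G v \<odot>\<^bsub>A\<^esub> G u) \<odot>\<^bsub>A\<^esub> q X"
      by (simp add: Gq[OF u, symmetric] A.Comp_assoc[OF qX G[OF u] G[OF v]])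
    finally show "G (v \<odot>\<^bsub>J\<^esub> u) \<odot>\<^bsub>A\<^esub> q X = (G v \<odot>\<^bsub>A\<^esub> G u) \<odot>\<^bsub>A\<^esub> q X" .
  qed
  let ?Q = "\<lparr>on_obj = Q, on_mor = G\<rparr>"
  have "is_functor J A ?Q"
    using A.hom_Obj(2)[OF q] G G_Id G_Comp by (auto simp: is_functor_def hom_def)
  moreover have "naturally_isomorphic J B (functor_comp F ?Q) W"
    unfolding naturally_isomorphic_def
    using e e_iso eG by (intro exI[of _ e]) (auto simp: functor_comp_def hom_def)
  ultimately show ?thesis
    by (auto simp: has_lifting_def is_lifting_def)
qed


section \<open>Lifting a pointwise \<open>\<omega>\<close>-colimit\<close>

text \<open>The lifting of \<open>G\<close> sends \<open>X\<close> to the colimit in \<open>A\<close> of the \<open>\<omega>\<close>-diagram that lifts \<open>W (X, -)\<close>. Since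
  \<open>F\<close> preserves that colimit, its image and \<open>G X\<close> are colimits of isomorphic diagrams.\<close>

lemma has_lifting_omega_colimit:
  assumes I: "category I" and A: "category A" and B: "category B"
    and F: "is_functor A B F"
    and colims: "has_omega_colimits A" and pres: "preserves_omega_colimits A B F"
    and W: "is_functor (prod_cat I omega_cat) B W" and G: "is_functor I B G"
    and lift: "has_lifting (prod_cat I omega_cat) A B F W"
    and colim: "\<And>X. X \<in> Obj I \<Longrightarrow>
      omega_colimit B (\<lambda>n. on_obj W (X, n)) (\<lambda>n. on_mor W (Id I X, (n, Suc n)))
        (on_obj G X) (\<lambda>n. k X n)"
    and nat: "\<And>X Y f n. f \<in> hom I X Y \<Longrightarrow>
      k Y n \<odot>\<^bsub>B\<^esub> on_mor W (f, (n, n)) = on_mor G f \<odot>\<^bsub>B\<^esub> k X n"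
  shows "has_lifting I A B F G"
proof -
  interpret I: category I by fact
  interpret A: category A by fact
  interpret B: category B by fact
  let ?J = "prod_cat I omega_cat"
  have J_Obj: "(X, n) \<in> Obj ?J" if "X \<in> Obj I" for X n
    using that by (simp add: prod_cat_def omega_cat_def)
  obtain E \<tau> where E: "is_functor ?J A E"
    and \<tau>: "\<And>X. X \<in> Obj ?J \<Longrightarrow> \<tau> X \<in> hom B (on_obj F (on_obj E X)) (on_obj W X)"
    and \<tau>_iso: "\<And>X. X \<in> Obj ?J \<Longrightarrow> isomorphism B (\<tau> X)"
    and \<tau>_nat: "\<And>u X Y. u \<in> hom ?J X Y \<Longrightarrow>
      \<tau> Y \<odot>\<^bsub>B\<^esub> on_mor F (on_mor E u) = on_mor W u \<odot>\<^bsub>B\<^esub> \<tau> X"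
    using lift by (auto simp: has_lifting_def is_lifting_def naturally_isomorphic_def
        functor_comp_def hom_def)
  define d where "d X n = on_mor E (Id I X, (n, Suc n))" for X n
  define w where "w X n = on_mor W (Id I X, (n, Suc n))" for X n
  have step: "(Id I X, (n, Suc n)) \<in> hom ?J (X, n) (X, Suc n)" if "X \<in> Obj I" for X n
    using hom_prod_omega[OF I.Id_hom[OF that]] by simp
  have across: "(f, (n, n)) \<in> hom ?J (X, n) (Y, n)" if "f \<in> hom I X Y" for f X Y n
    using hom_prod_omega[OF that] by simp
  have diagE: "omega_diagram A (\<lambda>n. on_obj E (X, n)) (d X)" if "X \<in> Obj I" for X
    using functor_hom[OF E step[OF that]] functor_Obj[OF E J_Obj[OF that]]
    by (simp add: omega_diagram_def d_def)
  have diagFE: "omega_diagram B (\<lambda>n. on_obj F (on_obj E (X, n))) (\<lambda>n. on_mor F (d X n))"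
    if "X \<in> Obj I" for X
    using diagE[OF that] functor_hom[OF F] functor_Obj[OF F] by (simp add: omega_diagram_def)
  have diagW: "omega_diagram B (\<lambda>n. on_obj W (X, n)) (w X)" if "X \<in> Obj I" for X
    using functor_hom[OF W step[OF that]] functor_Obj[OF W J_Obj[OF that]]
    by (simp add: omega_diagram_def w_def)
  have "\<exists>L g. omega_colimit A (\<lambda>n. on_obj E (X, n)) (d X) L g" if "X \<in> Obj I" for X
    using colims diagE[OF that] by (simp add: has_omega_colimits_def)
  then obtain L g where L: "\<And>X. X \<in> Obj I \<Longrightarrow>
      omega_colimit A (\<lambda>n. on_obj E (X, n)) (d X) (L X) (g X)"
    by metis
  note g = A.omega_colimit_cocone(2)[OF L] and L_Obj = A.omega_colimit_cocone(1)[OF L]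
  have FL: "omega_colimit B (\<lambda>n. on_obj F (on_obj E (X, n))) (\<lambda>n. on_mor F (d X n))
      (on_obj F (L X)) (\<lambda>n. on_mor F (g X n))" if "X \<in> Obj I" for X
    using pres diagE[OF that] L[OF that] by (auto simp: preserves_omega_colimits_def)
  have k: "k X n \<in> hom B (on_obj W (X, n)) (on_obj G X)" if "X \<in> Obj I" for X n
    by (rule B.omega_colimit_cocone[OF colim[OF that]])

  have "\<exists>h \<in> hom A (L X) (L Y). \<forall>n. h \<odot>\<^bsub>A\<^esub> g X n = g Y n \<odot>\<^bsub>A\<^esub> on_mor E (f, (n, n))"
    if f: "f \<in> hom I X Y" for f X Y
  proof (rule A.omega_colimit_map)
    note X = I.hom_Obj(1)[OF f] and Y = I.hom_Obj(2)[OF f]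
    show "omega_diagram A (\<lambda>n. on_obj E (X, n)) (d X)" "omega_diagram A (\<lambda>n. on_obj E (Y, n)) (d Y)"
      by (rule diagE[OF X], rule diagE[OF Y])
    show "omega_colimit A (\<lambda>n. on_obj E (X, n)) (d X) (L X) (g X)"
      "omega_colimit A (\<lambda>n. on_obj E (Y, n)) (d Y) (L Y) (g Y)"
      by (rule L[OF X], rule L[OF Y])
    show "on_mor E (f, (n, n)) \<in> hom A (on_obj E (X, n)) (on_obj E (Y, n))" for n
      by (rule functor_hom[OF E across[OF f]])
    show "on_mor E (f, (Suc n, Suc n)) \<odot>\<^bsub>A\<^esub> d X n = d Y n \<odot>\<^bsub>A\<^esub> on_mor E (f, (n, n))" for n
      unfolding d_def
      by (simp add: functor_Comp[OF E step[OF X] across[OF f], symmetric] Comp_prod_omega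
          functor_Comp[OF E across[OF f] step[OF Y], symmetric] I.Comp_Id[OF f] I.Id_Comp[OF f])
  qed
  then have "\<exists>h. h \<in> hom A (L (Dom I f)) (L (Cod I f)) \<and>
      (\<forall>n. h \<odot>\<^bsub>A\<^esub> g (Dom I f) n = g (Cod I f) n \<odot>\<^bsub>A\<^esub> on_mor E (f, (n, n)))"
    if "f \<in> Mor I" for f
    using that by (auto simp: hom_def)
  then obtain H where "\<And>f. f \<in> Mor I \<Longrightarrow> H f \<in> hom A (L (Dom I f)) (L (Cod I f)) \<and>
      (\<forall>n. H f \<odot>\<^bsub>A\<^esub> g (Dom I f) n = g (Cod I f) n \<odot>\<^bsub>A\<^esub> on_mor E (f, (n, n)))"
    by metis
  then have H: "H f \<in> hom A (L X) (L Y)"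
    and Hg: "H f \<odot>\<^bsub>A\<^esub> g X n = g Y n \<odot>\<^bsub>A\<^esub> on_mor E (f, (n, n))"
    if "f \<in> hom I X Y" for f X Y n
    using that by (auto simp: hom_def)
  have H_Id: "H (Id I X) = Id A (L X)" if X: "X \<in> Obj I" for X
  proof (rule A.omega_colimit_ext[OF diagE[OF X] L[OF X] H[OF I.Id_hom[OF X]] A.Id_hom[OF L_Obj[OF X]]])
    fix n
    have "on_mor E (Id I X, (n, n)) = Id A (on_obj E (X, n))"
      using functor_Id[OF E J_Obj[OF X]] by (simp add: prod_cat_def omega_cat_def)
    then show "H (Id I X) \<odot>\<^bsub>A\<^esub> g X n = Id A (L X) \<odot>\<^bsub>A\<^esub> g X n"
      by (simp add: Hg[OF I.Id_hom[OF X]] A.Comp_Id[OF g[OF X]] A.Id_Comp[OF g[OF X]])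
  qed
  have H_Comp: "H (f' \<odot>\<^bsub>I\<^esub> f) = H f' \<odot>\<^bsub>A\<^esub> H f"
    if f: "f \<in> hom I X Y" and f': "f' \<in> hom I Y Z" for f f' X Y Z
  proof (rule A.omega_colimit_ext[OF diagE L H[OF I.Comp_hom[OF f f']] A.Comp_hom[OF H[OF f] H[OF f']]])
    note X = I.hom_Obj(1)[OF f] and Y = I.hom_Obj(2)[OF f] and Z = I.hom_Obj(2)[OF f']
    show "X \<in> Obj I" "X \<in> Obj I"
      by (rule X)+
    fix n
    note Ef = functor_hom[OF E across[OF f], of n] and Ef' = functor_hom[OF E across[OF f'], of n]
    have "on_mor E (f' \<odot>\<^bsub>I\<^esub> f, (n, n)) = on_mor E (f', (n, n)) \<odot>\<^bsub>A\<^esub> on_mor E (f, (n, n))"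
      by (simp add: functor_Comp[OF E across[OF f] across[OF f'], symmetric] Comp_prod_omega)
    then have "H (f' \<odot>\<^bsub>I\<^esub> f) \<odot>\<^bsub>A\<^esub> g X n = (g Z n \<odot>\<^bsub>A\<^esub> on_mor E (f', (n, n))) \<odot>\<^bsub>A\<^esub> on_mor E (f, (n, n))"
      by (simp add: Hg[OF I.Comp_hom[OF f f']] A.Comp_assoc[OF Ef Ef' g[OF Z]])
    also have "\<dots> = H f' \<odot>\<^bsub>A\<^esub> (g Y n \<odot>\<^bsub>A\<^esub> on_mor E (f, (n, n)))"
      by (simp add: Hg[OF f', symmetric] A.Comp_assoc[OF Ef g[OF Y] H[OF f']])
    also have "\<dots> = (H f' \<odot>\<^bsub>A\<^esub> H f) \<odot>\<^bsub>A\<^esub> g X n"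
      by (simp add: Hg[OF f, symmetric] A.Comp_assoc[OF g[OF X] H[OF f] H[OF f']])
    finally show "H (f' \<odot>\<^bsub>I\<^esub> f) \<odot>\<^bsub>A\<^esub> g X n = (H f' \<odot>\<^bsub>A\<^esub> H f) \<odot>\<^bsub>A\<^esub> g X n" .
  qed

  have "\<exists>h \<in> hom B (on_obj F (L X)) (on_obj G X). isomorphism B h \<and>
      (\<forall>n. h \<odot>\<^bsub>B\<^esub> on_mor F (g X n) = k X n \<odot>\<^bsub>B\<^esub> \<tau> (X, n))" if X: "X \<in> Obj I" for X
  proof (rule B.omega_colimit_iso[OF diagFE[OF X] diagW[OF X] FL[OF X] colim[OF X, folded w_def]
        \<tau>[OF J_Obj[OF X]] \<tau>_iso[OF J_Obj[OF X]]])
    show "\<tau> (X, Suc n) \<odot>\<^bsub>B\<^esub> on_mor F (d X n) = w X n \<odot>\<^bsub>B\<^esub> \<tau> (X, n)" for n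
      unfolding d_def w_def by (rule \<tau>_nat[OF step[OF X]])
  qed
  then obtain \<theta> where \<theta>: "\<And>X. X \<in> Obj I \<Longrightarrow> \<theta> X \<in> hom B (on_obj F (L X)) (on_obj G X)"
    and \<theta>_iso: "\<And>X. X \<in> Obj I \<Longrightarrow> isomorphism B (\<theta> X)"
    and \<theta>g: "\<And>X n. X \<in> Obj I \<Longrightarrow> \<theta> X \<odot>\<^bsub>B\<^esub> on_mor F (g X n) = k X n \<odot>\<^bsub>B\<^esub> \<tau> (X, n)"
    by metis
  have \<theta>_nat: "\<theta> Y \<odot>\<^bsub>B\<^esub> on_mor F (H f) = on_mor G f \<odot>\<^bsub>B\<^esub> \<theta> X" if f: "f \<in> hom I X Y" for f X Y
  proof -
    note X = I.hom_Obj(1)[OF f] and Y = I.hom_Obj(2)[OF f]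
    note FH = functor_hom[OF F H[OF f]] and Gf = functor_hom[OF G f]
    show ?thesis
    proof (rule B.omega_colimit_ext[OF diagFE[OF X] FL[OF X] B.Comp_hom[OF FH \<theta>[OF Y]] B.Comp_hom[OF \<theta>[OF X] Gf]])
      fix n
      note gX = g[OF X, of n] and gY = g[OF Y, of n] and Ef = functor_hom[OF E across[OF f], of n]
        and Wf = functor_hom[OF W across[OF f], of n]
        and \<tau>X = \<tau>[OF J_Obj[OF X], of n] and \<tau>Y = \<tau>[OF J_Obj[OF Y], of n]
      note FgX = functor_hom[OF F gX] and FgY = functor_hom[OF F gY] and FEf = functor_hom[OF F Ef]
      have "(\<theta> Y \<odot>\<^bsub>B\<^esub> on_mor F (H f)) \<odot>\<^bsub>B\<^esub> on_mor F (g X n)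
          = (\<theta> Y \<odot>\<^bsub>B\<^esub> on_mor F (g Y n)) \<odot>\<^bsub>B\<^esub> on_mor F (on_mor E (f, (n, n)))"
        by (simp add: B.Comp_assoc[OF FgX FH \<theta>[OF Y]] functor_Comp[OF F gX H[OF f], symmetric]
            Hg[OF f] functor_Comp[OF F Ef gY] B.Comp_assoc[OF FEf FgY \<theta>[OF Y]])
      also have "\<dots> = (k Y n \<odot>\<^bsub>B\<^esub> on_mor W (f, (n, n))) \<odot>\<^bsub>B\<^esub> \<tau> (X, n)"
        by (simp add: \<theta>g[OF Y] B.Comp_assoc[OF FEf \<tau>Y k[OF Y]] \<tau>_nat[OF across[OF f]]
            B.Comp_assoc[OF \<tau>X Wf k[OF Y]])
      also have "\<dots> = (on_mor G f \<odot>\<^bsub>B\<^esub> \<theta> X) \<odot>\<^bsub>B\<^esub> on_mor F (g X n)"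
        by (simp add: nat[OF f] B.Comp_assoc[OF \<tau>X k[OF X] Gf] B.Comp_assoc[OF FgX \<theta>[OF X] Gf] \<theta>g[OF X])
      finally show "(\<theta> Y \<odot>\<^bsub>B\<^esub> on_mor F (H f)) \<odot>\<^bsub>B\<^esub> on_mor F (g X n)
          = (on_mor G f \<odot>\<^bsub>B\<^esub> \<theta> X) \<odot>\<^bsub>B\<^esub> on_mor F (g X n)" .
    qed
  qed

  let ?L = "\<lparr>on_obj = L, on_mor = H\<rparr>"
  have "is_functor I A ?L"
    using L_Obj H H_Id H_Comp by (auto simp: is_functor_def hom_def)
  moreover have "naturally_isomorphic I B (functor_comp F ?L) G"
    unfolding naturally_isomorphic_def
    using \<theta> \<theta>_iso \<theta>_nat by (intro exI[of _ \<theta>]) (auto simp: functor_comp_def hom_def)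
  ultimately show ?thesis
    by (auto simp: has_lifting_def is_lifting_def)
qed


section \<open>The tower of idempotents and the unfolding\<close>

text \<open>The step from \<open>m\<close> to \<open>n\<close> should be the power \<open>n - m\<close> of \<open>rho\<close>; idempotence collapses it to a
  distinction between \<open>m = n\<close> and \<open>m < n\<close>.\<close>

definition idempotent_tower ::
    "('i, 'im) cat \<Rightarrow> ('b, 'bm) cat \<Rightarrow>
     ('i, 'im, ('b, 'bm) retract, ('b, 'bm) retract_mor) functor_data \<Rightarrow>
     ('i \<times> nat, 'im \<times> (nat \<times> nat), 'b, 'bm) functor_data" where
  "idempotent_tower I B D =
     \<lparr> on_obj = (\<lambda>(X, n). top_obj (on_obj D X)),
       on_mor = (\<lambda>(f, (m, n)). if m = n then top_mor (on_mor D f)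
                   else rho B D (Cod I f) \<odot>\<^bsub>B\<^esub> top_mor (on_mor D f)) \<rparr>"

locale retract_diagram = I: category I + B: category B
  for I :: "('i, 'im) cat" and B :: "('b, 'bm) cat" +
  fixes D :: "('i, 'im, ('b, 'bm) retract, ('b, 'bm) retract_mor) functor_data"
  assumes D: "is_functor I (Retr B) D"
begin

lemma is_retract_D: "X \<in> Obj I \<Longrightarrow> is_retract B (on_obj D X)"
  using functor_Obj[OF D] by (simp add: Retr_def)

lemma retract_homs:
  assumes "X \<in> Obj I"
  shows "top_obj (on_obj D X) \<in> Obj B"
    and "sect (on_obj D X) \<in> hom B (sub_obj (on_obj D X)) (top_obj (on_obj D X))"
    and "retr (on_obj D X) \<in> hom B (top_obj (on_obj D X)) (sub_obj (on_obj D X))"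
    and "retr (on_obj D X) \<odot>\<^bsub>B\<^esub> sect (on_obj D X) = Id B (sub_obj (on_obj D X))"
  using is_retract_D[OF assms] by (simp_all add: is_retract_def)

lemma D_mor:
  assumes "f \<in> hom I X Y"
  shows sub_mor_hom: "sub_mor (on_mor D f) \<in> hom B (sub_obj (on_obj D X)) (sub_obj (on_obj D Y))"
    and top_mor_hom: "top_mor (on_mor D f) \<in> hom B (top_obj (on_obj D X)) (top_obj (on_obj D Y))"
    and sect_natural: "top_mor (on_mor D f) \<odot>\<^bsub>B\<^esub> sect (on_obj D X)
          = sect (on_obj D Y) \<odot>\<^bsub>B\<^esub> sub_mor (on_mor D f)"
    and retr_natural: "retr (on_obj D Y) \<odot>\<^bsub>B\<^esub> top_mor (on_mor D f)
          = sub_mor (on_mor D f) \<odot>\<^bsub>B\<^esub> retr (on_obj D X)"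
  using functor_hom[OF D assms] by (auto simp: Retr_def hom_def is_retract_mor_def)

lemma D_Id:
  assumes "X \<in> Obj I"
  shows "sub_mor (on_mor D (Id I X)) = Id B (sub_obj (on_obj D X))"
    and "top_mor (on_mor D (Id I X)) = Id B (top_obj (on_obj D X))"
  using functor_Id[OF D assms] by (simp_all add: Retr_def)

lemma D_Comp:
  assumes "f \<in> hom I X Y" "g \<in> hom I Y Z"
  shows "sub_mor (on_mor D (g \<odot>\<^bsub>I\<^esub> f)) = sub_mor (on_mor D g) \<odot>\<^bsub>B\<^esub> sub_mor (on_mor D f)"
    and "top_mor (on_mor D (g \<odot>\<^bsub>I\<^esub> f)) = top_mor (on_mor D g) \<odot>\<^bsub>B\<^esub> top_mor (on_mor D f)"
  using functor_Comp[OF D assms] by (simp_all add: Retr_def)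

lemma functor_Retr_proj: "is_functor I B (functor_comp Retr_proj D)"
proof -
  have "sub_obj (on_obj D X) \<in> Obj B" if "X \<in> Obj I" for X
    using is_retract_D[OF that] by (simp add: is_retract_def)
  then show ?thesis
    using sub_mor_hom D_Id(1) D_Comp(1)
    by (auto simp: is_functor_def functor_comp_def Retr_proj_def hom_def)
qed

lemma rho_hom: "X \<in> Obj I \<Longrightarrow> rho B D X \<in> hom B (top_obj (on_obj D X)) (top_obj (on_obj D X))"
  unfolding rho_def by (rule B.Comp_hom[OF retract_homs(3) retract_homs(2)])

lemma retr_rho:
  assumes X: "X \<in> Obj I"
  shows "retr (on_obj D X) \<odot>\<^bsub>B\<^esub> rho B D X = retr (on_obj D X)"
proof -
  note R = retract_homs[OF X]
  show ?thesis
    by (simp add: rho_def B.Comp_assoc[OF R(3) R(2) R(3), symmetric] R(4) B.Id_Comp[OF R(3)])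
qed

lemma rho_idem:
  assumes X: "X \<in> Obj I"
  shows "rho B D X \<odot>\<^bsub>B\<^esub> rho B D X = rho B D X"
proof -
  note R = retract_homs[OF X]
  have "rho B D X \<odot>\<^bsub>B\<^esub> rho B D X = sect (on_obj D X) \<odot>\<^bsub>B\<^esub> (retr (on_obj D X) \<odot>\<^bsub>B\<^esub> rho B D X)"
    using B.Comp_assoc[OF rho_hom[OF X] R(3) R(2)] by (simp add: rho_def)
  then show ?thesis
    by (simp add: retr_rho[OF X]) (simp add: rho_def)
qed

lemma rho_natural:
  assumes f: "f \<in> hom I X Y"
  shows "top_mor (on_mor D f) \<odot>\<^bsub>B\<^esub> rho B D X = rho B D Y \<odot>\<^bsub>B\<^esub> top_mor (on_mor D f)"
proof -
  note RX = retract_homs[OF I.hom_Obj(1)[OF f]] and RY = retract_homs[OF I.hom_Obj(2)[OF f]]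
    and s = sub_mor_hom[OF f] and t = top_mor_hom[OF f]
  show ?thesis
    by (simp add: rho_def B.Comp_assoc[OF RX(3) RX(2) t, symmetric] sect_natural[OF f]
        B.Comp_assoc[OF RX(3) s RY(2)] retr_natural[OF f, symmetric] B.Comp_assoc[OF t RY(3) RY(2)])
qed

lemma idempotent_tower_Comp:
  assumes f: "f \<in> hom I X Y" and g: "g \<in> hom I Y Z" and "m \<le> n" "n \<le> k"
  shows "on_mor (idempotent_tower I B D) (g \<odot>\<^bsub>I\<^esub> f, (m, k))
       = on_mor (idempotent_tower I B D) (g, (n, k)) \<odot>\<^bsub>B\<^esub> on_mor (idempotent_tower I B D) (f, (m, n))"
proof -
  note t = top_mor_hom[OF f] and u = top_mor_hom[OF g]
  note rY = rho_hom[OF I.hom_Obj(2)[OF f]] and rZ = rho_hom[OF I.hom_Obj(2)[OF g]]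
  let ?tu = "top_mor (on_mor D g) \<odot>\<^bsub>B\<^esub> top_mor (on_mor D f)"
  have late: "top_mor (on_mor D g) \<odot>\<^bsub>B\<^esub> (rho B D Y \<odot>\<^bsub>B\<^esub> top_mor (on_mor D f)) = rho B D Z \<odot>\<^bsub>B\<^esub> ?tu"
    by (simp add: B.Comp_assoc[OF t rY u, symmetric] rho_natural[OF g] B.Comp_assoc[OF t u rZ])
  have both: "(rho B D Z \<odot>\<^bsub>B\<^esub> top_mor (on_mor D g)) \<odot>\<^bsub>B\<^esub> (rho B D Y \<odot>\<^bsub>B\<^esub> top_mor (on_mor D f))
      = rho B D Z \<odot>\<^bsub>B\<^esub> ?tu"
    by (simp add: B.Comp_assoc[OF B.Comp_hom[OF t rY] u rZ] late
        B.Comp_assoc[OF B.Comp_hom[OF t u] rZ rZ, symmetric] rho_idem[OF I.hom_Obj(2)[OF g]])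
  have "Cod I f = Y" "Cod I g = Z" "Cod I (g \<odot>\<^bsub>I\<^esub> f) = Z"
    using f g I.Comp_hom[OF f g] by (auto simp: hom_def)
  then show ?thesis
    using \<open>m \<le> n\<close> \<open>n \<le> k\<close> late both B.Comp_assoc[OF t u rZ]
    by (auto simp: idempotent_tower_def D_Comp(2)[OF f g])
qed

lemma functor_idempotent_tower: "is_functor (prod_cat I omega_cat) B (idempotent_tower I B D)"
proof -
  have "on_mor (idempotent_tower I B D) (f, (m, n))
      \<in> hom B (top_obj (on_obj D (Dom I f))) (top_obj (on_obj D (Cod I f)))"
    if "f \<in> Mor I" for f m n
  proof -
    note t = top_mor_hom[of f "Dom I f" "Cod I f"]
    show ?thesis
      using that t B.Comp_hom[OF t rho_hom] I.Cod_in by (simp add: idempotent_tower_def hom_def)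
  qed
  moreover have "on_obj (idempotent_tower I B D) (X, n) = top_obj (on_obj D X)" for X n
    by (simp add: idempotent_tower_def)
  moreover have "on_mor (idempotent_tower I B D) (Id I X, (n, n)) = Id B (top_obj (on_obj D X))"
    if "X \<in> Obj I" for X n
    using D_Id(2)[OF that] by (simp add: idempotent_tower_def)
  ultimately show ?thesis
    using retract_homs(1) idempotent_tower_Comp
    by (auto simp: is_functor_def prod_cat_def omega_cat_def hom_def)
qed

lemma omega_colimit_idempotent_tower:
  assumes X: "X \<in> Obj I"
  shows "omega_colimit B (\<lambda>n. on_obj (idempotent_tower I B D) (X, n))
           (\<lambda>n. on_mor (idempotent_tower I B D) (Id I X, (n, Suc n)))
           (on_obj (functor_comp Retr_proj D) X) (\<lambda>n. retr (on_obj D X))"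
proof -
  have "on_mor (idempotent_tower I B D) (Id I X, (n, Suc n)) = rho B D X" for n
    using X by (simp add: idempotent_tower_def D_Id I.Id_in_Mor B.Comp_Id[OF rho_hom[OF X]])
  then show ?thesis
    using B.omega_colimit_retract[OF is_retract_D[OF X]]
    by (simp add: idempotent_tower_def functor_comp_def Retr_proj_def rho_def)
qed

end

locale retract_diagram_powers = retract_diagram +
  fixes T :: "('i, 'b, 'bm) powers"
  assumes T: "are_powers I B D T"
begin

lemma pow_0:
  "X \<in> Obj I \<Longrightarrow> pow T X 0 = top_obj (on_obj D X)"
  "X \<in> Obj I \<Longrightarrow> pr_alpha T X 0 = Id B (top_obj (on_obj D X))"
  using T by (simp_all add: are_powers_def)

lemma pow_Suc:
  "X \<in> Obj I \<Longrightarrow> is_binary_product B (top_obj (on_obj D X)) (pow T X n)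
     (pow T X (Suc n)) (pr_alpha T X (Suc n)) (pr_pi T X (Suc n))"
  using T by (simp add: are_powers_def)

lemma pr_pi_hom: "X \<in> Obj I \<Longrightarrow> pr_pi T X (Suc n) \<in> hom B (pow T X (Suc n)) (pow T X n)"
  using pow_Suc by (simp add: is_binary_product_def)

lemma pr_alpha_hom:
  assumes "X \<in> Obj I"
  shows "pr_alpha T X n \<in> hom B (pow T X n) (top_obj (on_obj D X))"
proof (cases n)
  case 0
  then show ?thesis
    using B.Id_hom[OF retract_homs(1)] assms by (simp add: pow_0)
next
  case (Suc k)
  then show ?thesis
    using pow_Suc[OF assms, of k] by (simp add: is_binary_product_def)
qed

lemma pow_Suc_pair:
  assumes "X \<in> Obj I" "u \<in> hom B Q (top_obj (on_obj D X))" "v \<in> hom B Q (pow T X n)"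
  shows "\<exists>!h. h \<in> hom B Q (pow T X (Suc n)) \<and>
           pr_alpha T X (Suc n) \<odot>\<^bsub>B\<^esub> h = u \<and> pr_pi T X (Suc n) \<odot>\<^bsub>B\<^esub> h = v"
  using pow_Suc[OF assms(1), of n] B.hom_Obj(1)[OF assms(2)] assms(2,3)
  by (simp add: is_binary_product_def)

lemma sigma:
  assumes X: "X \<in> Obj I"
  shows sigma_hom: "sigma B D T X n \<in> hom B (pow T X n) (pow T X (Suc n))"
    and alpha_sigma: "pr_alpha T X (Suc n) \<odot>\<^bsub>B\<^esub> sigma B D T X n = rho B D X \<odot>\<^bsub>B\<^esub> pr_alpha T X n"
proof -
  note \<alpha> = pr_alpha_hom[OF X, of n]
  show "sigma B D T X n \<in> hom B (pow T X n) (pow T X (Suc n))"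
    "pr_alpha T X (Suc n) \<odot>\<^bsub>B\<^esub> sigma B D T X n = rho B D X \<odot>\<^bsub>B\<^esub> pr_alpha T X n"
    using theI'[OF pow_Suc_pair[OF X B.Comp_hom[OF \<alpha> rho_hom[OF X]] B.Id_hom[OF B.hom_Obj(1)[OF \<alpha>]]]]
    by (simp_all add: sigma_def)
qed

lemma pow_mor:
  assumes f: "f \<in> hom I X Y"
  shows pow_mor_hom: "pow_mor I B D T f n \<in> hom B (pow T X n) (pow T Y n)"
    and alpha_pow_mor: "pr_alpha T Y n \<odot>\<^bsub>B\<^esub> pow_mor I B D T f n
          = top_mor (on_mor D f) \<odot>\<^bsub>B\<^esub> pr_alpha T X n"
proof -
  note X = I.hom_Obj(1)[OF f] and Y = I.hom_Obj(2)[OF f]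
  have "pow_mor I B D T f n \<in> hom B (pow T X n) (pow T Y n) \<and>
      pr_alpha T Y n \<odot>\<^bsub>B\<^esub> pow_mor I B D T f n = top_mor (on_mor D f) \<odot>\<^bsub>B\<^esub> pr_alpha T X n"
  proof (induction n)
    case 0
    show ?case
      using top_mor_hom[OF f] X Y
      by (simp add: pow_0 B.Comp_Id[OF top_mor_hom[OF f]] B.Id_Comp[OF top_mor_hom[OF f]])
  next
    case (Suc n)
    have *: "Dom I f = X" "Cod I f = Y"
      using f by (auto simp: hom_def)
    show ?case
      using theI'[OF pow_Suc_pair[OF Y B.Comp_hom[OF pr_alpha_hom[OF X] top_mor_hom[OF f]]
            B.Comp_hom[OF pr_pi_hom[OF X] conjunct1[OF Suc]]]]
      by (simp add: *)
  qed
  then show "pow_mor I B D T f n \<in> hom B (pow T X n) (pow T Y n)"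
    "pr_alpha T Y n \<odot>\<^bsub>B\<^esub> pow_mor I B D T f n = top_mor (on_mor D f) \<odot>\<^bsub>B\<^esub> pr_alpha T X n"
    by auto
qed

lemma sigma_chain:
  assumes Y: "Y \<in> Obj I" and h: "h \<in> hom B Q (pow T Y m)"
  shows sigma_chain_hom: "sigma_chain B D T Y m k h \<in> hom B Q (pow T Y (m + k))"
    and alpha_sigma_chain: "pr_alpha T Y (m + k) \<odot>\<^bsub>B\<^esub> sigma_chain B D T Y m k h
          = (if k = 0 then pr_alpha T Y m \<odot>\<^bsub>B\<^esub> h else rho B D Y \<odot>\<^bsub>B\<^esub> (pr_alpha T Y m \<odot>\<^bsub>B\<^esub> h))"
proof -
  note r = rho_hom[OF Y] and \<alpha> = pr_alpha_hom[OF Y]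
  have hom: "sigma_chain B D T Y m k h \<in> hom B Q (pow T Y (m + k))" for k
  proof (induction k)
    case 0
    show ?case using h by simp
  next
    case (Suc k)
    show ?case using B.Comp_hom[OF Suc sigma_hom[OF Y]] by simp
  qed
  show "sigma_chain B D T Y m k h \<in> hom B Q (pow T Y (m + k))"
    by (rule hom)
  show "pr_alpha T Y (m + k) \<odot>\<^bsub>B\<^esub> sigma_chain B D T Y m k h
      = (if k = 0 then pr_alpha T Y m \<odot>\<^bsub>B\<^esub> h else rho B D Y \<odot>\<^bsub>B\<^esub> (pr_alpha T Y m \<odot>\<^bsub>B\<^esub> h))"
  proof (induction k)
    case 0
    show ?case by simp
  next
    case (Suc k)
    have "pr_alpha T Y (m + Suc k) \<odot>\<^bsub>B\<^esub> sigma_chain B D T Y m (Suc k) h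
        = rho B D Y \<odot>\<^bsub>B\<^esub> (pr_alpha T Y (m + k) \<odot>\<^bsub>B\<^esub> sigma_chain B D T Y m k h)"
      by (simp add: B.Comp_assoc[OF hom sigma_hom[OF Y] \<alpha>, symmetric] alpha_sigma[OF Y]
          B.Comp_assoc[OF hom \<alpha> r])
    also have "\<dots> = rho B D Y \<odot>\<^bsub>B\<^esub> (pr_alpha T Y m \<odot>\<^bsub>B\<^esub> h)"
      by (simp add: Suc B.Comp_assoc[OF B.Comp_hom[OF h \<alpha>] r r, symmetric] rho_idem[OF Y])
    finally show ?case by simp
  qed
qed

text \<open>Every \<open>sigma\<close> contributes one \<open>rho\<close> in front of \<open>pr_alpha\<close>, and by idempotence a nonempty chain of
  them contributes exactly one.\<close>

lemma alpha_natural: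
  assumes f: "f \<in> hom I X Y" and "m \<le> n"
  shows "pr_alpha T Y n \<odot>\<^bsub>B\<^esub> on_mor (unfolding_functor I B D T) (f, (m, n))
       = on_mor (idempotent_tower I B D) (f, (m, n)) \<odot>\<^bsub>B\<^esub> pr_alpha T X m"
    and "on_mor (unfolding_functor I B D T) (f, (m, n)) \<in> hom B (pow T X m) (pow T Y n)"
proof -
  note X = I.hom_Obj(1)[OF f] and Y = I.hom_Obj(2)[OF f]
  have *: "Cod I f = Y"
    using f by (simp add: hom_def)
  show "on_mor (unfolding_functor I B D T) (f, (m, n)) \<in> hom B (pow T X m) (pow T Y n)"
    using sigma_chain_hom[OF Y pow_mor_hom[OF f], of m "n - m"] \<open>m \<le> n\<close>
    by (simp add: unfolding_functor_def *)
  show "pr_alpha T Y n \<odot>\<^bsub>B\<^esub> on_mor (unfolding_functor I B D T) (f, (m, n))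
      = on_mor (idempotent_tower I B D) (f, (m, n)) \<odot>\<^bsub>B\<^esub> pr_alpha T X m"
    using alpha_sigma_chain[OF Y pow_mor_hom[OF f], of m "n - m"] \<open>m \<le> n\<close>
    by (simp add: unfolding_functor_def idempotent_tower_def * alpha_pow_mor[OF f]
        B.Comp_assoc[OF pr_alpha_hom[OF X] top_mor_hom[OF f] rho_hom[OF Y]])
qed

end

section \<open>Lifting the retracts\<close>

lemma (in category) is_projection_Comp_iso:
  assumes p: "is_projection C p" and t: "t \<in> hom C Q (Dom C p)" and iso: "isomorphism C t"
  shows "is_projection C (p \<odot> t)"
proof -
  obtain b' p' where prod: "is_binary_product C (Cod C p) b' (Dom C p) p p'"
    using p by (auto simp: is_projection_def)
  then have p_hom: "p \<in> hom C (Dom C p) (Cod C p)" and p'_hom: "p' \<in> hom C (Dom C p) b'"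
    by (auto simp: is_binary_product_def)
  obtain s where s: "s \<in> hom C (Dom C p) Q" and st: "s \<odot> t = Id C Q"
    and ts: "t \<odot> s = Id C (Dom C p)"
    using t iso by (auto simp: isomorphism_def hom_def)
  have "\<exists>!h. h \<in> hom C R Q \<and> (p \<odot> t) \<odot> h = u \<and> (p' \<odot> t) \<odot> h = v"
    if R: "R \<in> Obj C" and u: "u \<in> hom C R (Cod C p)" and v: "v \<in> hom C R b'" for R u v
  proof -
    have uniq: "\<exists>!h. h \<in> hom C R (Dom C p) \<and> p \<odot> h = u \<and> p' \<odot> h = v"
      using prod R u v by (simp add: is_binary_product_def)
    then obtain h where h: "h \<in> hom C R (Dom C p)" "p \<odot> h = u" "p' \<odot> h = v"
      by blast
    have tsh: "t \<odot> (s \<odot> h) = h"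
      by (simp add: Comp_assoc[OF h(1) s t, symmetric] ts Id_Comp[OF h(1)])
    show ?thesis
    proof (rule ex1I[of _ "s \<odot> h"])
      note sh = Comp_hom[OF h(1) s]
      show "s \<odot> h \<in> hom C R Q \<and> (p \<odot> t) \<odot> (s \<odot> h) = u \<and> (p' \<odot> t) \<odot> (s \<odot> h) = v"
        by (simp add: sh Comp_assoc[OF sh t p_hom] Comp_assoc[OF sh t p'_hom] tsh h)
    next
      fix k assume k: "k \<in> hom C R Q \<and> (p \<odot> t) \<odot> k = u \<and> (p' \<odot> t) \<odot> k = v"
      then have k_hom: "k \<in> hom C R Q" by blast
      have "t \<odot> k = h"
        using uniq h k Comp_hom[OF k_hom t]
        by (metis Comp_assoc[OF k_hom t p_hom] Comp_assoc[OF k_hom t p'_hom])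
      then show "k = s \<odot> h"
        by (metis Comp_assoc[OF k_hom t s] st Id_Comp[OF k_hom])
    qed
  qed
  moreover have "Dom C (p \<odot> t) = Q" "Cod C (p \<odot> t) = Cod C p" "p \<odot> t \<in> Mor C"
    using Comp_hom[OF t p_hom] by (auto simp: hom_def)
  moreover have "Cod C p \<in> Obj C" "b' \<in> Obj C"
    using prod by (auto simp: is_binary_product_def)
  ultimately have "is_binary_product C (Cod C (p \<odot> t)) b' (Dom C (p \<odot> t)) (p \<odot> t) (p' \<odot> t)"
    using Comp_hom[OF t p_hom] Comp_hom[OF t p'_hom] hom_Obj(1)[OF t]
    by (simp add: is_binary_product_def)
  with \<open>p \<odot> t \<in> Mor C\<close> show ?thesis
    unfolding is_projection_def by blast
qed

theorem theorem6p3: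
  fixes A :: "('a, 'am) cat"
    and B :: "('b, 'bm) cat"
    and I :: "('i, 'im) cat"
    and F :: "('a, 'am, 'b, 'bm) functor_data"
    and D :: "('i, 'im, ('b, 'bm) retract, ('b, 'bm) retract_mor) functor_data"
    and T :: "('i, 'b, 'bm) powers"
  assumes "category A" and "category B" and "category I"
    and "is_functor A B F"
    and "is_functor I (Retr B) D"
    and "has_omega_colimits A"
    and "has_nonempty_finite_products B"
    and "preserves_omega_colimits A B F"
    and "projectable A B F"
    and "are_powers I B D T"
    and "has_lifting (prod_cat I omega_cat) A B F (unfolding_functor I B D T)"
  shows "has_lifting I A B F (functor_comp Retr_proj D)"
proof -
  interpret retract_diagram_powers I B D T
    using assms(2,3,5,10)
    by (intro retract_diagram_powers.intro retract_diagram.intro retract_diagram_axioms.intro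
        retract_diagram_powers_axioms.intro)
  let ?J = "prod_cat I omega_cat" and ?W = "idempotent_tower I B D"
  note F = \<open>is_functor A B F\<close>
  have J: "category ?J"
    by (rule category_prod[OF \<open>category I\<close> category_omega])
  have J_Obj: "(X, n) \<in> Obj ?J" if "X \<in> Obj I" for X n
    using that by (simp add: prod_cat_def omega_cat_def)
  obtain E \<tau> where E: "is_functor ?J A E"
    and \<tau>: "\<And>X. X \<in> Obj ?J \<Longrightarrow>
      \<tau> X \<in> hom B (on_obj F (on_obj E X)) (on_obj (unfolding_functor I B D T) X)"
    and \<tau>_iso: "\<And>X. X \<in> Obj ?J \<Longrightarrow> isomorphism B (\<tau> X)"
    and \<tau>_nat: "\<And>u X Y. u \<in> hom ?J X Y \<Longrightarrow>
      \<tau> Y \<odot>\<^bsub>B\<^esub> on_mor F (on_mor E u) = on_mor (unfolding_functor I B D T) u \<odot>\<^bsub>B\<^esub> \<tau> X"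
    using \<open>has_lifting ?J A B F (unfolding_functor I B D T)\<close>
    by (auto simp: has_lifting_def is_lifting_def naturally_isomorphic_def functor_comp_def hom_def)
  have \<tau>_pow: "\<tau> (X, n) \<in> hom B (on_obj F (on_obj E (X, n))) (pow T X n)" if "X \<in> Obj I" for X n
    using \<tau>[OF J_Obj[OF that, of n]] by (simp add: unfolding_functor_def)
  \<comment> \<open>Only from the second level on is the first factor split off by a product projection: level 0 of
    the unfolding is a single copy of the ambient object, and its identity need not be a projection.
    The lifting is therefore shifted by one level, which does not affect the constant tower.\<close>
  define S where "S = \<lparr>on_obj = (\<lambda>(X, n). on_obj E (X, Suc n)),
      on_mor = (\<lambda>(f, (m, n)). on_mor E (f, (Suc m, Suc n)))\<rparr>"
  have S: "is_functor ?J A S"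
  proof -
    have "on_mor E (Id I X, (Suc n, Suc n)) = Id A (on_obj E (X, Suc n))" if "X \<in> Obj I" for X n
      using functor_Id[OF E J_Obj[OF that, of "Suc n"]] by (simp add: prod_cat_def omega_cat_def)
    moreover have "on_mor E (g \<odot>\<^bsub>I\<^esub> f, (Suc m, Suc k))
        = on_mor E (g, (Suc n, Suc k)) \<odot>\<^bsub>A\<^esub> on_mor E (f, (Suc m, Suc n))"
      if "f \<in> hom I X Y" "g \<in> hom I Y Z" "m \<le> n" "n \<le> k" for f g X Y Z m n k
      using that functor_Comp[OF E hom_prod_omega[OF that(1)] hom_prod_omega[OF that(2)],
          of "Suc m" "Suc n" "Suc k"]
      by (simp add: Comp_prod_omega)
    ultimately show ?thesis
      using functor_Obj[OF E J_Obj] functor_hom[OF E hom_prod_omega]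
      by (auto simp: is_functor_def S_def prod_cat_def omega_cat_def hom_def)
  qed
  define p where "p = (\<lambda>(X, n). pr_alpha T X (Suc n) \<odot>\<^bsub>B\<^esub> \<tau> (X, Suc n))"
  have "has_lifting ?J A B F ?W"
  proof (rule has_lifting_if_natural_projection[OF J \<open>category A\<close> \<open>category B\<close> F \<open>projectable A B F\<close> S
        functor_idempotent_tower])
    fix Xn assume "Xn \<in> Obj ?J"
    then obtain X n where Xn: "Xn = (X, n)" and X: "X \<in> Obj I"
      by (auto simp: prod_cat_def)
    note \<alpha> = pr_alpha_hom[OF X, of "Suc n"]
    show "p Xn \<in> hom B (on_obj F (on_obj S Xn)) (on_obj ?W Xn)"
      using B.Comp_hom[OF \<tau>_pow[OF X] \<alpha>] by (simp add: Xn p_def S_def idempotent_tower_def)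
    have "is_projection B (pr_alpha T X (Suc n))"
      using \<alpha> pow_Suc[OF X, of n] by (auto simp: is_projection_def hom_def)
    moreover have "\<tau> (X, Suc n) \<in> hom B (on_obj F (on_obj E (X, Suc n))) (Dom B (pr_alpha T X (Suc n)))"
      using \<tau>_pow[OF X, of "Suc n"] \<alpha> by (simp add: hom_def)
    ultimately show "is_projection B (p Xn)"
      using B.is_projection_Comp_iso \<tau>_iso[OF J_Obj[OF X]] by (simp add: Xn p_def)
  next
    fix Xm Yn u assume u: "u \<in> hom ?J Xm Yn"
    then obtain f X Y m n where uf: "u = (f, (m, n))" "Xm = (X, m)" "Yn = (Y, n)"
      and f: "f \<in> hom I X Y" and mn: "m \<le> n"
      by (auto simp: prod_cat_def omega_cat_def hom_def)
    note X = I.hom_Obj(1)[OF f] and Y = I.hom_Obj(2)[OF f]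
    have mn': "Suc m \<le> Suc n"
      using mn by simp
    note u' = hom_prod_omega[OF f mn'] and U = alpha_natural(2)[OF f mn']
    note FEu = functor_hom[OF F functor_hom[OF E u']]
    have W: "on_mor ?W (f, (Suc m, Suc n)) = on_mor ?W (f, (m, n))"
      by (simp add: idempotent_tower_def)
    have W_hom: "on_mor ?W (f, (m, n)) \<in> hom B (top_obj (on_obj D X)) (top_obj (on_obj D Y))"
      using functor_hom[OF functor_idempotent_tower hom_prod_omega[OF f mn]]
      by (simp add: idempotent_tower_def)
    have "p (Y, n) \<odot>\<^bsub>B\<^esub> on_mor F (on_mor S (f, (m, n)))
        = (pr_alpha T Y (Suc n) \<odot>\<^bsub>B\<^esub> on_mor (unfolding_functor I B D T) (f, (Suc m, Suc n)))
          \<odot>\<^bsub>B\<^esub> \<tau> (X, Suc m)"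
      by (simp add: p_def S_def B.Comp_assoc[OF FEu \<tau>_pow[OF Y] pr_alpha_hom[OF Y]] \<tau>_nat[OF u']
          B.Comp_assoc[OF \<tau>_pow[OF X] U pr_alpha_hom[OF Y]])
    also have "\<dots> = on_mor ?W (f, (m, n)) \<odot>\<^bsub>B\<^esub> p (X, m)"
      by (simp add: alpha_natural(1)[OF f mn'] W p_def
          B.Comp_assoc[OF \<tau>_pow[OF X] pr_alpha_hom[OF X] W_hom])
    finally show "p Yn \<odot>\<^bsub>B\<^esub> on_mor F (on_mor S u) = on_mor ?W u \<odot>\<^bsub>B\<^esub> p Xm"
      by (simp add: uf)
  qed
  then show ?thesis
  proof (rule has_lifting_omega_colimit[OF \<open>category I\<close> \<open>category A\<close> \<open>category B\<close> F
        \<open>has_omega_colimits A\<close> \<open>preserves_omega_colimits A B F\<close> functor_idempotent_tower functor_Retr_proj])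
    show "omega_colimit B (\<lambda>n. on_obj ?W (X, n)) (\<lambda>n. on_mor ?W (Id I X, (n, Suc n)))
        (on_obj (functor_comp Retr_proj D) X) (\<lambda>n. retr (on_obj D X))" if "X \<in> Obj I" for X
      by (rule omega_colimit_idempotent_tower[OF that])
    show "retr (on_obj D Y) \<odot>\<^bsub>B\<^esub> on_mor ?W (f, (n, n))
        = on_mor (functor_comp Retr_proj D) f \<odot>\<^bsub>B\<^esub> retr (on_obj D X)"
      if "f \<in> hom I X Y" for f X Y n
      using retr_natural[OF that]
      by (simp add: idempotent_tower_def functor_comp_def Retr_proj_def)
  qed
qed

end
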